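(* There is a constant $K>1$ such that for every integer $n\ge 2$ and every real $t$ with $$\sqrt{n}\le t\le \frac{2^{\sqrt{2\log_2 n}}}{\sqrt{\log_2 n}}\,n,$$ there is a connected graph $H$ with $n$ vertices whose geometric pebbling threshold lies between $t/K$ and $Kt$.
   Context: Pebbling: a distribution on a graph assigns a nonnegative integer number of pebbles to each vertex. A pebbling move removes two pebbles from a vertex having at least two pebbles and adds one pebble to an adjacent vertex. A vertex is pebblable if some sequence of pebbling moves from the distribution ends with at least one pebble on it; a distribution is solvable if every vertex is pebblable. The geometric distribution on $\{0,1,2,\dots\}$ with parameter $0<p\le 1$ assigns probability $p(1-p)^k$ to $k$. For a graph $H$ with $n>0$ vertices, the geometric pebbling threshold of $H$ is the unique positive real $x$ such that, if an independent geometrically distributed number of pebbles with parameter $(1+x/n)^{-1}$ is placed on each vertex of $H$, the probability that the distribution is solvable equals $\tfrac12$. *)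

theory Defs
  imports "HOL-Probability.Probability"
begin

definition simple_graph :: "(nat \<Rightarrow> nat \<Rightarrow> bool) \<Rightarrow> nat \<Rightarrow> bool" where
  "simple_graph E n \<longleftrightarrow>
     (\<forall>u v. E u v \<longrightarrow> u < n \<and> v < n) \<and> (\<forall>u v. E u v \<longrightarrow> E v u) \<and> (\<forall>v. \<not> E v v)"

definition connected_graph :: "(nat \<Rightarrow> nat \<Rightarrow> bool) \<Rightarrow> nat \<Rightarrow> bool" where
  "connected_graph E n \<longleftrightarrow> (\<forall>u<n. \<forall>v<n. E\<^sup>*\<^sup>* u v)"

definition pebbling_move :: "(nat \<Rightarrow> nat \<Rightarrow> bool) \<Rightarrow> (nat \<Rightarrow> nat) \<Rightarrow> (nat \<Rightarrow> nat) \<Rightarrow> bool" where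
  "pebbling_move E d d' \<longleftrightarrow>
     (\<exists>v w. E v w \<and> 2 \<le> d v \<and> d' = (d(v := d v - 2))(w := d w + 1))"

definition pebblable :: "(nat \<Rightarrow> nat \<Rightarrow> bool) \<Rightarrow> (nat \<Rightarrow> nat) \<Rightarrow> nat \<Rightarrow> bool" where
  "pebblable E d r \<longleftrightarrow> (\<exists>d'. (pebbling_move E)\<^sup>*\<^sup>* d d' \<and> 1 \<le> d' r)"

definition solvable :: "(nat \<Rightarrow> nat \<Rightarrow> bool) \<Rightarrow> nat \<Rightarrow> (nat \<Rightarrow> nat) \<Rightarrow> bool" where
  "solvable E n d \<longleftrightarrow> (\<forall>r<n. pebblable E d r)"

definition solve_prob :: "(nat \<Rightarrow> nat \<Rightarrow> bool) \<Rightarrow> nat \<Rightarrow> real \<Rightarrow> real" where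
  "solve_prob E n p =
     measure_pmf.prob (Pi_pmf {0..<n} 0 (\<lambda>_. geometric_pmf p)) {d. solvable E n d}"

definition geom_threshold :: "(nat \<Rightarrow> nat \<Rightarrow> bool) \<Rightarrow> nat \<Rightarrow> real" where
  "geom_threshold E n = (THE x. 0 < x \<and> solve_prob E n (inverse (1 + x / real n)) = 1/2)"

end

theory Submission
  imports Defs
begin

text \<open>
  All graphs are spiders: a centre with \<open>m\<close> legs of length \<open>L \<approx> log (n a\<^sup>2 / (1 + 2 a))\<close>, where
  \<open>a = t / n\<close> is the mean number of pebbles per vertex, and otherwise only pendant vertices.
  The number of pebbles that the pendant vertices can send to the centre is a sum of independent
  geometric variables of mean \<open>a\<^sup>2 / (1 + 2 a)\<close>; once \<open>a\<close> is a large multiple of \<open>t / n\<close> it exceeds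
  \<open>2\<^sup>L\<close>, and every vertex is pebblable from the centre. If \<open>a\<close> is a small multiple of \<open>t / n\<close>, the
  centre does not help the end of a leg, and with \<open>m \<approx> n / (2 L)\<close> legs the pebbles on some leg are
  too few to reach its end: their weight \<open>\<Sum> 2\<^sup>-\<^sup>j X\<^sub>j\<close> is less than \<open>1 / 2\<close> with probability
  about \<open>2 powr (- k\<^sup>2 / 2 - k log k)\<close>, \<open>k = log a\<close>, which is of larger order than \<open>1 / m\<close> up to
  the upper end of the range of \<open>t\<close>.

  That the threshold exists, is unique, and is located by such one-sided bounds follows from a
  coupling: for \<open>a < b\<close>, a geometric variable of mean \<open>b\<close> is the sum of one of mean \<open>a\<close> and an
  independent variable that vanishes with probability at least \<open>a / b\<close>, so that the probability of
  solvability is strictly increasing and continuous in the mean.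
\<close>

section \<open>Coupling of geometric distributions and the threshold\<close>

text \<open>Indexing the law by its mean turns the parameter \<open>(1 + x / n)\<close> inverse into
  mean \<open>x / n\<close> per vertex, so the threshold is \<open>n\<close> times the mean at which
  solvability has probability 1/2.\<close>

definition geom_mean :: "real \<Rightarrow> nat pmf" where
  "geom_mean a = geometric_pmf (inverse (1 + a))"

lemma pmf_geom_mean:
  assumes "0 \<le> a"
  shows "pmf (geom_mean a) k = (a / (1 + a)) ^ k / (1 + a)"
proof -
  have "1 - inverse (1 + a) = a / (1 + a)"
    using assms by (simp add: field_simps)
  then show ?thesis
    using assms by (simp add: geom_mean_def inverse_le_1_iff field_simps)
qed

definition geom_increment :: "real \<Rightarrow> real \<Rightarrow> nat pmf" where
  "geom_increment a b =
     bind_pmf (bernoulli_pmf (a / b)) (\<lambda>c. if c then return_pmf 0 else geom_mean b)"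

text \<open>Keeping the factor \<open>y - x\<close> on the left avoids a division, so that the
  coupling below also covers \<open>a = b\<close>.\<close>

lemma sum_geometric_convolution:
  fixes x y :: real
  shows "(y - x) * (\<Sum>i\<le>k. x ^ i * y ^ (k - i)) = y ^ Suc k - x ^ Suc k"
proof -
  have "y ^ Suc k - x ^ Suc k = (y - x) * (\<Sum>p<Suc k. y ^ p * x ^ (Suc k - Suc p))"
    using diff_power_eq_sum[of y k x] by (simp add: mult.commute)
  also have "(\<Sum>p<Suc k. y ^ p * x ^ (Suc k - Suc p)) = (\<Sum>i\<le>k. x ^ i * y ^ (k - i))"
    by (rule sum.reindex_bij_witness[of _ "\<lambda>i. k - i" "\<lambda>i. k - i"]) auto
  finally show ?thesis by simp
qed

lemma pmf_map_add_pair: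
  "pmf (map_pmf (\<lambda>(x, y). x + y) (pair_pmf M N)) (k::nat) =
     (\<Sum>i\<le>k. pmf M i * pmf N (k - i))"
proof -
  have "(\<lambda>(x, y). x + y) -` {k} = (\<lambda>i. (i, k - i)) ` {..k}"
    by (auto simp: image_iff)
  then have "pmf (map_pmf (\<lambda>(x, y). x + y) (pair_pmf M N)) k =
      measure_pmf.prob (pair_pmf M N) ((\<lambda>i. (i, k - i)) ` {..k})"
    by (simp add: pmf_map)
  also have "\<dots> = (\<Sum>z\<in>(\<lambda>i. (i, k - i)) ` {..k}. pmf (pair_pmf M N) z)"
    by (intro measure_measure_pmf_finite) auto
  also have "\<dots> = (\<Sum>i\<le>k. pmf M i * pmf N (k - i))"
    by (subst sum.reindex) (auto simp: inj_on_def pmf_pair)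
  finally show ?thesis .
qed

lemma pmf_geom_increment:
  assumes "0 < a" "a \<le> b"
  shows "pmf (geom_increment a b) k =
    a / b * (if k = 0 then 1 else 0) + (1 - a / b) * pmf (geom_mean b) k"
  using assms by (simp add: geom_increment_def pmf_bind indicator_def)

text \<open>In terms of generating functions:
  \<open>(1 + a - a z) / (1 + b - b z) = a / b + (1 - a / b) / (1 + b - b z)\<close>.\<close>

lemma geom_mean_eq_add_increment:
  assumes "0 < a" "a \<le> b"
  shows "geom_mean b = map_pmf (\<lambda>(x, y). x + y) (pair_pmf (geom_mean a) (geom_increment a b))"
proof (rule pmf_eqI)
  fix k
  define x y where "x = a / (1 + a)" and "y = b / (1 + b)"
  have dxy: "y - x = (b - a) / ((1 + a) * (1 + b))"
    using assms by (simp add: x_def y_def field_simps)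
  \<comment> \<open>The point mass at 0 in the increment contributes only the term
    \<open>i = k\<close>; its geometric part gives a convolution of two geometric sequences.\<close>
  have "(\<Sum>i\<le>k. pmf (geom_mean a) i * pmf (geom_increment a b) (k - i)) =
      (\<Sum>i\<le>k. (if i = k then a / b * pmf (geom_mean a) k else 0) +
        (1 - a / b) / ((1 + a) * (1 + b)) * (x ^ i * y ^ (k - i)))"
  proof (intro sum.cong refl)
    fix i assume i: "i \<in> {..k}"
    define g u v where "g = 1 - a / b" and "u = 1 + a" and "v = 1 + b"
    have "pmf (geom_mean a) i * pmf (geom_increment a b) (k - i) =
        x ^ i / u * (a / b * (if k - i = 0 then 1 else 0) + g * (y ^ (k - i) / v))"
      using assms by (simp add: pmf_geom_increment pmf_geom_mean x_def y_def g_def u_def v_def)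
    also have "\<dots> = (if i = k then a / b * (x ^ k / u) else 0) + g / (u * v) * (x ^ i * y ^ (k - i))"
      using i by (auto simp: divide_inverse algebra_simps)
    finally show "pmf (geom_mean a) i * pmf (geom_increment a b) (k - i) =
        (if i = k then a / b * pmf (geom_mean a) k else 0) +
        (1 - a / b) / ((1 + a) * (1 + b)) * (x ^ i * y ^ (k - i))"
      using assms by (simp add: pmf_geom_mean x_def g_def u_def v_def)
  qed
  also have "\<dots> = a / b * pmf (geom_mean a) k +
      (1 - a / b) / ((1 + a) * (1 + b)) * (\<Sum>i\<le>k. x ^ i * y ^ (k - i))"
    by (simp add: sum.distrib sum_distrib_left)
  also have "(1 - a / b) / ((1 + a) * (1 + b)) = (y - x) / b"
    using assms by (simp add: dxy field_simps)
  also have "a / b * pmf (geom_mean a) k + (y - x) / b * (\<Sum>i\<le>k. x ^ i * y ^ (k - i)) =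
      (a * pmf (geom_mean a) k + (y - x) * (\<Sum>i\<le>k. x ^ i * y ^ (k - i))) / b"
    by (simp add: add_divide_distrib)
  also have "a * pmf (geom_mean a) k = x ^ Suc k"
    using assms by (simp add: pmf_geom_mean x_def)
  also have "(x ^ Suc k + (y - x) * (\<Sum>i\<le>k. x ^ i * y ^ (k - i))) / b = y ^ Suc k / b"
    by (simp add: sum_geometric_convolution)
  also have "\<dots> = pmf (geom_mean b) k"
    using assms by (simp add: pmf_geom_mean y_def)
  finally show "pmf (geom_mean b) k =
      pmf (map_pmf (\<lambda>(x, y). x + y) (pair_pmf (geom_mean a) (geom_increment a b))) k"
    by (simp add: pmf_map_add_pair)
qed

section \<open>Random distributions and monotonicity of solvability\<close>

definition pebble_pmf :: "nat \<Rightarrow> real \<Rightarrow> (nat \<Rightarrow> nat) pmf" where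
  "pebble_pmf n a = Pi_pmf {0..<n} 0 (\<lambda>_. geom_mean a)"

lemma solve_prob_eq:
  "solve_prob E n (inverse (1 + x / real n)) =
     measure_pmf.prob (pebble_pmf n (x / real n)) {d. solvable E n d}"
  by (simp add: solve_prob_def pebble_pmf_def geom_mean_def)

text \<open>The same move is available in the larger distribution and preserves the order.\<close>

lemma pebbling_move_mono:
  assumes "pebbling_move E d e" "d \<le> d'"
  shows "\<exists>e'. pebbling_move E d' e' \<and> e \<le> e'"
proof -
  obtain v w where vw: "E v w" "2 \<le> d v" "e = (d(v := d v - 2))(w := d w + 1)"
    using assms(1) by (auto simp: pebbling_move_def)
  have le: "d u \<le> d' u" for u
    using assms(2) by (simp add: le_fun_def)
  have "pebbling_move E d' ((d'(v := d' v - 2))(w := d' w + 1))"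
    unfolding pebbling_move_def using vw le[of v] by (intro exI[of _ v] exI[of _ w]) simp
  moreover have "e \<le> (d'(v := d' v - 2))(w := d' w + 1)"
    using le by (auto simp: vw(3) le_fun_def diff_le_mono)
  ultimately show ?thesis by blast
qed

lemma pebbling_moves_mono:
  assumes "(pebbling_move E)\<^sup>*\<^sup>* d e" "d \<le> d'"
  shows "\<exists>e'. (pebbling_move E)\<^sup>*\<^sup>* d' e' \<and> e \<le> e'"
  using assms
proof (induction rule: rtranclp_induct)
  case (step y z)
  then obtain y' where y': "(pebbling_move E)\<^sup>*\<^sup>* d' y'" "y \<le> y'" by blast
  obtain z' where "pebbling_move E y' z'" "z \<le> z'"
    using pebbling_move_mono[OF step(2) y'(2)] by blast
  then show ?case
    using y'(1) by (meson rtranclp.rtrancl_into_rtrancl)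
qed blast

lemma pebblable_mono:
  assumes "pebblable E d r" "d \<le> d'"
  shows "pebblable E d' r"
proof -
  obtain e where e: "(pebbling_move E)\<^sup>*\<^sup>* d e" "1 \<le> e r"
    using assms(1) by (auto simp: pebblable_def)
  obtain e' where e': "(pebbling_move E)\<^sup>*\<^sup>* d' e'" "e \<le> e'"
    using pebbling_moves_mono[OF e(1) assms(2)] by blast
  have "1 \<le> e' r"
    using e(2) le_funD[OF e'(2), of r] by linarith
  then show ?thesis
    unfolding pebblable_def using e'(1) by blast
qed

lemma solvable_mono: "solvable E n d \<Longrightarrow> d \<le> d' \<Longrightarrow> solvable E n d'"
  unfolding solvable_def using pebblable_mono by blast

lemma solvable_if_pos: "(\<And>v. v < n \<Longrightarrow> 1 \<le> d v) \<Longrightarrow> solvable E n d"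
  unfolding solvable_def pebblable_def by blast

lemma not_solvable_zero: "0 < n \<Longrightarrow> \<not> solvable E n (\<lambda>_. 0)"
proof -
  have "d' = (\<lambda>_. 0)" if "(pebbling_move E)\<^sup>*\<^sup>* (\<lambda>_. 0) d'" for d'
    using that by (induction rule: rtranclp_induct) (auto simp: pebbling_move_def)
  then show "0 < n \<Longrightarrow> \<not> solvable E n (\<lambda>_. 0)"
    unfolding solvable_def pebblable_def by fastforce
qed

section \<open>Existence, uniqueness and location of the threshold\<close>

context
  fixes E :: "nat \<Rightarrow> nat \<Rightarrow> bool" and n :: nat and F :: "real \<Rightarrow> real"
  assumes n_pos: "0 < n"
  defines "F \<equiv> \<lambda>a. measure_pmf.prob (pebble_pmf n a) {d. solvable E n d}"
begin

text \<open>Both distributions live on one space of pairs (pebbles of mean \<open>a\<close>,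
  increment), where the event for \<open>a\<close> is contained in the event for \<open>b\<close>.
  One outcome of positive probability makes the inclusion strict; a union bound over the nonzero
  increments limits the difference.\<close>

lemma prob_solvable_coupled:
  assumes "0 < a" "a < b"
  shows "F a < F b" "F b - F a \<le> real n * (1 - a / b)"
proof -
  define R where "R = Pi_pmf {0..<n} (0, 0) (\<lambda>_. pair_pmf (geom_mean a) (geom_increment a b))"
  define A B where "A = {h :: nat \<Rightarrow> nat \<times> nat. solvable E n (fst \<circ> h)}"
    and "B = {h. solvable E n ((\<lambda>(x, y). x + y) \<circ> h)}"
  have "pebble_pmf n a = Pi_pmf {0..<n} 0 (\<lambda>_. map_pmf fst (pair_pmf (geom_mean a) (geom_increment a b)))"
    by (simp add: pebble_pmf_def map_fst_pair_pmf)
  also have "\<dots> = map_pmf (\<lambda>h. fst \<circ> h) R"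
    unfolding R_def by (rule Pi_pmf_map) auto
  finally have Fa: "F a = measure_pmf.prob R A"
    by (simp add: F_def A_def vimage_def)
  have "pebble_pmf n b = Pi_pmf {0..<n} 0
      (\<lambda>_. map_pmf (\<lambda>(x, y). x + y) (pair_pmf (geom_mean a) (geom_increment a b)))"
    using assms by (simp add: pebble_pmf_def geom_mean_eq_add_increment[symmetric])
  also have "\<dots> = map_pmf (\<lambda>h. (\<lambda>(x, y). x + y) \<circ> h) R"
    unfolding R_def by (rule Pi_pmf_map) auto
  finally have Fb: "F b = measure_pmf.prob R B"
    by (simp add: F_def B_def vimage_def)
  have "A \<subseteq> B"
  proof
    fix h assume "h \<in> A"
    moreover have "fst \<circ> h \<le> (\<lambda>(x, y). x + y) \<circ> h"
      by (simp add: le_fun_def case_prod_beta)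
    ultimately show "h \<in> B"
      unfolding A_def B_def using solvable_mono by blast
  qed
  then have diff: "F b - F a = measure_pmf.prob R (B - A)"
    unfolding Fa Fb by (subst measure_pmf.finite_measure_Diff) auto
  \<comment> \<open>No pebbles at mean \<open>a\<close> and one on each vertex at mean
    \<open>b\<close>; off the vertex set \<open>h0\<close> takes the default value, as positive
    probability requires.\<close>
  define h0 where "h0 = (\<lambda>v. if v < n then (0::nat, 1::nat) else (0, 0))"
  have "h0 \<in> B - A"
  proof -
    have "fst \<circ> h0 = (\<lambda>_. 0)" by (auto simp: h0_def)
    moreover have "solvable E n ((\<lambda>(x, y). x + y) \<circ> h0)"
      by (rule solvable_if_pos) (simp add: h0_def)
    ultimately show ?thesis
      using not_solvable_zero[OF n_pos] by (simp add: A_def B_def)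
  qed
  then have "pmf R h0 \<le> measure_pmf.prob R (B - A)"
    by (simp add: measure_pmf.finite_measure_mono measure_pmf_single[symmetric])
  moreover have "pmf R h0 > 0"
  proof -
    have "pmf R h0 = (\<Prod>v\<in>{0..<n}. pmf (pair_pmf (geom_mean a) (geom_increment a b)) (h0 v))"
      unfolding R_def by (rule pmf_Pi') (auto simp: h0_def)
    also have "\<dots> > 0"
      using assms by (intro prod_pos) (auto simp: h0_def pmf_pair pmf_geom_mean pmf_geom_increment)
    finally show ?thesis .
  qed
  ultimately show "F a < F b" using diff by linarith
  \<comment> \<open>If all increments vanish, the two distributions coincide. The second set only
    accounts for non-default values off the vertex set and is null.\<close>
  have "B - A \<subseteq> (\<Union>v\<in>{0..<n}. {h. snd (h v) \<noteq> 0}) \<union> {h. \<exists>v. v \<ge> n \<and> h v \<noteq> (0, 0)}"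
  proof
    fix h assume h: "h \<in> B - A"
    show "h \<in> (\<Union>v\<in>{0..<n}. {h. snd (h v) \<noteq> 0}) \<union> {h. \<exists>v. v \<ge> n \<and> h v \<noteq> (0, 0)}"
    proof (rule ccontr)
      assume "\<not> ?thesis"
      then have z: "snd (h v) = 0" for v
        by (cases "v < n") auto
      then have "(\<lambda>(x, y). x + y) \<circ> h = fst \<circ> h"
        by (auto simp: fun_eq_iff split: prod.splits) (metis snd_conv)
      then show False using h by (simp add: A_def B_def)
    qed
  qed
  then have "measure_pmf.prob R (B - A) \<le>
      measure_pmf.prob R ((\<Union>v\<in>{0..<n}. {h. snd (h v) \<noteq> 0}) \<union> {h. \<exists>v. v \<ge> n \<and> h v \<noteq> (0, 0)})"
    by (intro measure_pmf.finite_measure_mono) auto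
  also have "\<dots> \<le> measure_pmf.prob R (\<Union>v\<in>{0..<n}. {h. snd (h v) \<noteq> 0}) +
      measure_pmf.prob R {h. \<exists>v. v \<ge> n \<and> h v \<noteq> (0, 0)}"
    by (intro measure_Un_le) auto
  also have "measure_pmf.prob R {h. \<exists>v. v \<ge> n \<and> h v \<noteq> (0, 0)} = 0"
    unfolding measure_pmf_zero_iff R_def using set_Pi_pmf_subset[of "{0..<n}"] by fastforce
  also have "measure_pmf.prob R (\<Union>v\<in>{0..<n}. {h. snd (h v) \<noteq> 0}) \<le>
      (\<Sum>v\<in>{0..<n}. measure_pmf.prob R {h. snd (h v) \<noteq> 0})"
    by (intro measure_pmf.finite_measure_subadditive_finite) auto
  also have "\<dots> \<le> (\<Sum>v\<in>{0..<n}. 1 - a / b)"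
  proof (rule sum_mono)
    fix v assume v: "v \<in> {0..<n}"
    have "measure_pmf.prob R {h. snd (h v) \<noteq> 0} =
        measure_pmf.prob (map_pmf (\<lambda>h. h v) R) {z. snd z \<noteq> 0}"
      by (simp add: vimage_def)
    also have "map_pmf (\<lambda>h. h v) R = pair_pmf (geom_mean a) (geom_increment a b)"
      using v by (simp add: R_def Pi_pmf_component)
    also have "measure_pmf.prob \<dots> {z. snd z \<noteq> 0} =
        measure_pmf.prob (map_pmf snd (pair_pmf (geom_mean a) (geom_increment a b))) (- {0})"
      by (simp add: vimage_def Compl_eq)
    also have "\<dots> = 1 - pmf (geom_increment a b) 0"
      using measure_pmf.prob_compl[of "{0}" "geom_increment a b"]
      by (simp add: map_snd_pair_pmf measure_pmf_single Compl_eq_Diff_UNIV)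
    also have "\<dots> \<le> 1 - a / b"
      using assms by (simp add: pmf_geom_increment)
    finally show "measure_pmf.prob R {h. snd (h v) \<noteq> 0} \<le> 1 - a / b" .
  qed
  finally show "F b - F a \<le> real n * (1 - a / b)"
    using diff by simp
qed

text \<open>Since \<open>1 - y / z \<le> (z - y) / a\<close> for \<open>a \<le> y < z\<close>, the
  coupling makes \<open>F\<close> Lipschitz with constant \<open>n / a\<close>.\<close>

lemma prob_solvable_continuous:
  assumes "0 < a"
  shows "continuous_on {a..b} F"
proof (rule continuous_onI)
  fix x e :: real assume x: "x \<in> {a..b}" and e: "0 < e"
  have lip: "\<bar>F z - F y\<bar> \<le> real n / a * \<bar>z - y\<bar>" if "a \<le> y" "a \<le> z" for y z
  proof -
    have *: "\<bar>F z - F y\<bar> \<le> real n / a * \<bar>z - y\<bar>" if yz: "a \<le> y" "y < z" for y z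
    proof -
      have "\<bar>F z - F y\<bar> = F z - F y"
        using prob_solvable_coupled(1)[of y z] yz assms by simp
      also have "\<dots> \<le> real n * (1 - y / z)"
        using prob_solvable_coupled(2)[of y z] yz assms by simp
      also have "1 - y / z \<le> (z - y) / a"
      proof -
        have "1 - y / z = (z - y) / z" using yz assms by (simp add: field_simps)
        also have "\<dots> \<le> (z - y) / a" using yz assms by (intro divide_left_mono) auto
        finally show ?thesis .
      qed
      finally show ?thesis using yz n_pos by (simp add: mult_left_mono field_simps)
    qed
    show ?thesis
      using *[of y z] *[of z y] that by (cases y z rule: linorder_cases) (auto simp: abs_minus_commute)
  qed
  show "\<exists>d>0. \<forall>x'\<in>{a..b}. dist x' x < d \<longrightarrow> dist (F x') (F x) \<le> e"
  proof (intro exI[of _ "e * a / real n"] conjI ballI impI)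
    show "0 < e * a / real n" using e assms n_pos by simp
    fix x' assume x': "x' \<in> {a..b}" "dist x' x < e * a / real n"
    have "dist (F x') (F x) \<le> real n / a * \<bar>x' - x\<bar>"
      using lip[of x x'] x x' by (simp add: dist_real_def)
    also have "\<dots> \<le> e"
      using x'(2) assms n_pos by (simp add: dist_real_def field_simps)
    finally show "dist (F x') (F x) \<le> e" .
  qed
qed

text \<open>The intermediate value theorem yields a solution in the interval, and strict
  monotonicity makes it the only positive one, so the definite description denotes it.\<close>

lemma geom_threshold_between:
  assumes "0 < a" "a \<le> b"
    and "F (a / real n) \<le> 1 / 2" "1 / 2 \<le> F (b / real n)"
  shows "a \<le> geom_threshold E n" "geom_threshold E n \<le> b"
proof -
  have le: "a / real n \<le> b / real n"
    using assms by (simp add: divide_right_mono)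
  obtain y where y: "a / real n \<le> y" "y \<le> b / real n" "F y = 1 / 2"
    using IVT'[of F "a / real n" "1 / 2" "b / real n"] assms le
      prob_solvable_continuous[of "a / real n" "b / real n"] n_pos by auto
  define x where "x = y * real n"
  have x: "a \<le> x" "x \<le> b" "F (x / real n) = 1 / 2"
    using y n_pos by (auto simp: x_def field_simps)
  have "geom_threshold E n = x"
    unfolding geom_threshold_def solve_prob_eq
  proof (rule the_equality)
    show "0 < x \<and> measure_pmf.prob (pebble_pmf n (x / real n)) {d. solvable E n d} = 1 / 2"
      using x assms by (simp add: F_def)
  next
    fix z assume z: "0 < z \<and> measure_pmf.prob (pebble_pmf n (z / real n)) {d. solvable E n d} = 1 / 2"
    then have "F (z / real n) = F (x / real n)" "0 < z / real n" "0 < x / real n"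
      using x assms n_pos by (auto simp: F_def)
    then have "z / real n = x / real n"
      using prob_solvable_coupled(1) by (metis less_irrefl linorder_neqE_linordered_idom)
    then show "z = x" using n_pos by simp
  qed
  then show "a \<le> geom_threshold E n" "geom_threshold E n \<le> b" using x by auto
qed

end

section \<open>Pebbling on spiders\<close>

lemma pebbling_moves_along_edge:
  assumes "E v w" "v \<noteq> w" "2 * k \<le> d v"
  shows "(pebbling_move E)\<^sup>*\<^sup>* d (d(v := d v - 2 * k, w := d w + k))"
  using assms(3)
proof (induction k)
  case (Suc k)
  let ?e = "d(v := d v - 2 * k, w := d w + k)"
  have "pebbling_move E ?e ((?e(v := ?e v - 2))(w := ?e w + 1))"
    unfolding pebbling_move_def
    using Suc.prems assms(1,2) by (intro exI[of _ v] exI[of _ w]) simp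
  moreover have "(?e(v := ?e v - 2))(w := ?e w + 1) = d(v := d v - 2 * Suc k, w := d w + Suc k)"
    using assms(2) by (auto simp: fun_eq_iff)
  ultimately show ?case
    using Suc by (metis Suc_leD mult_Suc_right add_leD2 rtranclp.rtrancl_into_rtrancl)
qed simp

lemma pebbling_moves_gather:
  assumes "finite A" "c \<notin> A" "\<And>v. v \<in> A \<Longrightarrow> E v c"
  shows "\<exists>e. (pebbling_move E)\<^sup>*\<^sup>* d e \<and> e c = d c + (\<Sum>v\<in>A. d v div 2) \<and>
           (\<forall>u. u \<notin> A \<longrightarrow> u \<noteq> c \<longrightarrow> e u = d u)"
  using assms
proof (induction A rule: finite_induct)
  case empty
  then show ?case by auto
next
  case (insert v A)
  then obtain e where e: "(pebbling_move E)\<^sup>*\<^sup>* d e" "e c = d c + (\<Sum>v\<in>A. d v div 2)"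
    "\<And>u. u \<notin> A \<Longrightarrow> u \<noteq> c \<Longrightarrow> e u = d u"
    by auto
  have vc: "v \<noteq> c" "E v c" using insert by auto
  have ev: "e v = d v" using e(3) insert vc by blast
  let ?e = "e(v := e v - 2 * (d v div 2), c := e c + d v div 2)"
  have "(pebbling_move E)\<^sup>*\<^sup>* e ?e"
    using pebbling_moves_along_edge[of E v c "d v div 2" e] vc ev by simp
  then have "(pebbling_move E)\<^sup>*\<^sup>* d ?e"
    using e(1) by (rule rtranclp_trans[rotated])
  moreover have "?e c = d c + (\<Sum>v\<in>insert v A. d v div 2)"
    using e(2) insert by simp
  moreover have "\<forall>u. u \<notin> insert v A \<longrightarrow> u \<noteq> c \<longrightarrow> ?e u = d u"
    using e(3) by simp
  ultimately show ?case by blast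
qed

text \<open>Half of the pebbles survive each step of a walk, so \<open>2 ^ j\<close> of them deliver
  one pebble after \<open>j\<close> steps.\<close>

lemma pebblable_at_distance:
  assumes "\<And>v. \<not> E v v" "(E ^^ j) c r" "2 ^ j \<le> d c"
  shows "pebblable E d r"
  using assms(2,3)
proof (induction j arbitrary: c d)
  case 0
  then show ?case by (auto simp: pebblable_def)
next
  case (Suc j)
  then obtain b where b: "E c b" "(E ^^ j) b r"
    by (metis relpowp_Suc_D2)
  then have "c \<noteq> b" using assms(1) by blast
  let ?e = "d(c := d c - 2 * 2 ^ j, b := d b + 2 ^ j)"
  have moves: "(pebbling_move E)\<^sup>*\<^sup>* d ?e"
    using pebbling_moves_along_edge[of E c b "2 ^ j" d] b(1) \<open>c \<noteq> b\<close> Suc.prems(2) by simp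
  have "pebblable E ?e r"
    by (rule Suc.IH[OF b(2)]) simp
  then show ?case
    unfolding pebblable_def using rtranclp_trans[OF moves] by blast
qed

text \<open>A move takes at least as much weight from \<open>u\<close> as it adds at
  \<open>v\<close>. The weight need not be linear in the number of pebbles, which allows counting
  pairs.\<close>

lemma potential_pebbling_moves:
  fixes f :: "nat \<Rightarrow> nat \<Rightarrow> real"
  assumes E: "\<And>u v. E u v \<Longrightarrow> u < n \<and> v < n \<and> u \<noteq> v"
    and f: "\<And>u v k l. E u v \<Longrightarrow> f v (Suc l) - f v l \<le> f u (k + 2) - f u k"
    and moves: "(pebbling_move E)\<^sup>*\<^sup>* d e"
  shows "(\<Sum>v<n. f v (e v)) \<le> (\<Sum>v<n. f v (d v))"
  using moves
proof (induction rule: rtranclp_induct)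
  case (step y z)
  then obtain u v where uv: "E u v" "2 \<le> y u" "z = (y(u := y u - 2))(v := y v + 1)"
    by (auto simp: pebbling_move_def)
  note luv = E[OF uv(1)]
  have split: "(\<Sum>w<n. g w) = g u + g v + (\<Sum>w\<in>{..<n} - {u, v}. g w)" for g :: "nat \<Rightarrow> real"
  proof -
    have "(\<Sum>w<n. g w) = (\<Sum>w\<in>{u, v}. g w) + (\<Sum>w\<in>{..<n} - {u, v}. g w)"
      using luv by (subst sum.subset_diff[of "{u, v}"]) auto
    then show ?thesis using luv by simp
  qed
  have "(\<Sum>w\<in>{..<n} - {u, v}. f w (z w)) = (\<Sum>w\<in>{..<n} - {u, v}. f w (y w))"
    by (rule sum.cong) (auto simp: uv(3))
  moreover have "f u (z u) + f v (z v) \<le> f u (y u) + f v (y v)"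
  proof -
    have "z u = y u - 2" "z v = Suc (y v)" using luv by (auto simp: uv(3))
    then show ?thesis using f[OF uv(1), of "y v" "y u - 2"] uv(2)
      by (simp add: numeral_2_eq_2 Suc_diff_Suc)
  qed
  ultimately have "(\<Sum>w<n. f w (z w)) \<le> (\<Sum>w<n. f w (y w))"
    unfolding split by simp
  then show ?case using step.IH by simp
qed simp

text \<open>The spider has centre \<open>0\<close>, \<open>m\<close> legs of length \<open>L\<close> and otherwise only pendant vertices
  at the centre: for \<open>i < m\<close> and \<open>j < L\<close> the vertex \<open>i * L + j + 1\<close> is the one at depth
  \<open>j + 1\<close> of leg \<open>i\<close>, and every vertex beyond \<open>m * L\<close> is pendant.\<close>

definition spider_parent :: "nat \<Rightarrow> nat \<Rightarrow> nat \<Rightarrow> nat" where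
  "spider_parent m L v = (if v \<le> m * L \<and> (v - 1) mod L \<noteq> 0 then v - 1 else 0)"

definition spider :: "nat \<Rightarrow> nat \<Rightarrow> nat \<Rightarrow> nat \<Rightarrow> nat \<Rightarrow> bool" where
  "spider n m L u v \<longleftrightarrow> u < n \<and> v < n \<and>
     (0 < v \<and> u = spider_parent m L v \<or> 0 < u \<and> v = spider_parent m L u)"

lemma spider_parent_less: "0 < v \<Longrightarrow> spider_parent m L v < v"
  by (simp add: spider_parent_def)

lemma not_spider_refl: "\<not> spider n m L v v"
  using spider_parent_less[of v m L] by (auto simp: spider_def)

lemma spider_edge: "spider n m L u v \<Longrightarrow> u < n \<and> v < n \<and> u \<noteq> v"
  using not_spider_refl by (metis spider_def)

lemma simple_graph_spider: "simple_graph (spider n m L) n"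
  unfolding simple_graph_def using not_spider_refl by (auto simp: spider_def)

definition spider_depth :: "nat \<Rightarrow> nat \<Rightarrow> nat \<Rightarrow> nat" where
  "spider_depth m L v = (if v = 0 then 0 else if v \<le> m * L then (v - 1) mod L + 1 else 1)"

lemma spider_depth_le: "1 \<le> L \<Longrightarrow> spider_depth m L v \<le> L"
  by (simp add: spider_depth_def Suc_leI)

text \<open>The parent of a positive vertex has a smaller number and depth one less, so strong
  induction on the number applies.\<close>

lemma spider_walk_from_centre:
  assumes "1 \<le> L" "v < n"
  shows "(spider n m L ^^ spider_depth m L v) 0 v"
  using assms(2)
proof (induction v rule: less_induct)
  case (less v)
  show ?case
  proof (cases "v = 0")
    case False
    then have pos: "0 < v" by simp
    let ?p = "spider_parent m L v"
    have "spider_depth m L v = Suc (spider_depth m L ?p)"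
    proof (cases "v \<le> m * L \<and> (v - 1) mod L \<noteq> 0")
      case True
      then obtain w where w: "v = Suc (Suc w)"
        by (cases v; cases "v - 1") auto
      with True show ?thesis
        by (simp add: spider_depth_def spider_parent_def mod_Suc split: if_splits)
    next
      case False
      then show ?thesis using pos by (auto simp: spider_depth_def spider_parent_def)
    qed
    moreover have "spider n m L ?p v"
      using pos less.prems spider_parent_less[of v m L] by (auto simp: spider_def)
    moreover have "(spider n m L ^^ spider_depth m L ?p) 0 ?p"
      using less pos spider_parent_less[of v m L] by simp
    ultimately show ?thesis
      by (metis relpowp_Suc_I)
  qed (simp add: spider_depth_def)
qed

lemma connected_graph_spider:
  assumes "1 \<le> L"
  shows "connected_graph (spider n m L) n"
proof -
  have from0: "(spider n m L)\<^sup>*\<^sup>* 0 v" if "v < n" for v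
    using spider_walk_from_centre[OF assms that] by (rule relpowp_imp_rtranclp)
  have "symp (spider n m L)"
    by (auto simp: symp_def spider_def)
  then have "symp (spider n m L)\<^sup>*\<^sup>*"
    by (rule symp_rtranclp)
  then have "(spider n m L)\<^sup>*\<^sup>* v 0" if "v < n" for v
    using from0[OF that] by (auto dest: sympD)
  then show ?thesis
    unfolding connected_graph_def using from0 by (meson rtranclp_trans)
qed

lemma spider_solvable:
  assumes "1 \<le> L" "2 ^ L \<le> d 0 + (\<Sum>v\<in>{m * L <..< n}. d v div 2)"
  shows "solvable (spider n m L) n d"
  unfolding solvable_def
proof (intro allI impI)
  fix r assume r: "r < n"
  have "spider n m L v 0" if "v \<in> {m * L <..< n}" for v
    using that by (auto simp: spider_def spider_parent_def)
  then obtain e where e: "(pebbling_move (spider n m L))\<^sup>*\<^sup>* d e"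
    "e 0 = d 0 + (\<Sum>v\<in>{m * L <..< n}. d v div 2)"
    using pebbling_moves_gather[of "{m * L <..< n}" 0 "spider n m L" d] by auto
  have "(2::nat) ^ spider_depth m L r \<le> 2 ^ L"
    using spider_depth_le[OF assms(1)] by (intro power_increasing) auto
  then have "pebblable (spider n m L) e r"
    using assms(2) e(2) not_spider_refl
    by (intro pebblable_at_distance[OF _ spider_walk_from_centre[OF assms(1) r]])
      (auto simp del: power_increasing_iff)
  then show "pebblable (spider n m L) d r"
    unfolding pebblable_def using rtranclp_trans[OF e(1)] by blast
qed

text \<open>A pebble at distance \<open>j\<close> from the end of leg \<open>i\<close> is worth \<open>2\<^sup>-\<^sup>j\<close>. Off that leg and the
  centre only \<^emph>\<open>pairs\<close> of pebbles count, each being worth one pebble at the centre.\<close>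

lemma spider_not_solvable:
  assumes L: "1 \<le> L" and i: "i < m" and n: "m * L < n"
    and leg: "(\<Sum>j<L. real (d (Suc i * L - j)) / 2 ^ j) < 1 / 2"
    and rest: "real (d 0) + (\<Sum>v\<in>{0<..<n}. real (d v div 2)) \<le> 2 ^ L / 2"
  shows "\<not> solvable (spider n m L) n d"
proof
  assume solv: "solvable (spider n m L) n d"
  define r where "r = Suc i * L"
  define B where "B = {i * L <.. r}"
  define f where "f = (\<lambda>v k. if v \<in> B then real k / 2 ^ (r - v)
    else if v = 0 then real k / 2 ^ L else real (k div 2) / 2 ^ L)"
  have "Suc i * L \<le> m * L" using i by (intro mult_right_mono) auto
  then have r: "r \<le> m * L" "r < n" "r \<in> B" "0 < r"
    using n L by (auto simp: r_def B_def)
  have f_step: "f v (Suc l) - f v l \<le> f u (k + 2) - f u k" if edge: "spider n m L u v" for u v k l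
  proof -
    have half: "real (Suc l div 2) - real (l div 2) \<le> 1"
      by (simp add: div_Suc)
    have gain: "f v (Suc l) - f v l \<le> (if v \<in> B then 1 / 2 ^ (r - v) else 1 / 2 ^ L)"
      using half by (auto simp: f_def diff_divide_distrib[symmetric] intro!: divide_right_mono)
    have loss: "f u (k + 2) - f u k =
        (if u \<in> B then 2 / 2 ^ (r - u) else if u = 0 then 2 / 2 ^ L else 1 / 2 ^ L)"
      by (auto simp: f_def add_divide_distrib)
    have parent_B: "spider_parent m L w = (if w = Suc (i * L) then 0 else w - 1)" if "w \<in> B" for w
    proof -
      define j where "j = w - Suc (i * L)"
      have j: "w = Suc (i * L + j)" "j < L"
        using that by (auto simp: B_def r_def j_def)
      have "w \<le> m * L" using that r by (simp add: B_def)
      then show ?thesis using j by (simp add: spider_parent_def)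
    qed
    \<comment> \<open>A child outside the leg of a vertex on it would have to be
      \<open>r + 1\<close>; but \<open>r\<close> is a multiple of \<open>L\<close>, so
      \<open>r + 1\<close> has parent 0.\<close>
    have parent_not_B: "spider_parent m L w \<notin> B" if "w \<notin> B" for w
    proof
      assume *: "spider_parent m L w \<in> B"
      then have "w - 1 \<in> B" "(w - 1) mod L \<noteq> 0"
        by (auto simp: spider_parent_def B_def split: if_splits)
      moreover from this have "w - 1 = r" using that by (auto simp: B_def)
      ultimately show False by (simp add: r_def)
    qed
    \<comment> \<open>A move stays on the leg, leaves it, enters it (only from the centre to its
      first vertex), or stays off it.\<close>
    consider "u \<in> B" "v \<in> B" "r - u \<le> Suc (r - v)" | "u \<in> B" "v \<notin> B"
      | "u = 0" "v = Suc (i * L)" "v \<in> B" | "u \<notin> B" "v \<notin> B"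
    proof -
      have "u = spider_parent m L v \<or> v = spider_parent m L u"
        using edge by (auto simp: spider_def)
      moreover have "0 \<notin> B" by (simp add: B_def)
      moreover have "v - 1 \<in> B" if "v \<in> B" "v \<noteq> Suc (i * L)"
        using that by (auto simp: B_def)
      ultimately have "u \<in> B \<Longrightarrow> v \<in> B \<Longrightarrow> r - u \<le> Suc (r - v)"
        "u \<notin> B \<Longrightarrow> v \<in> B \<Longrightarrow> u = 0 \<and> v = Suc (i * L)"
        using parent_B[of u] parent_B[of v] parent_not_B[of u] by (auto split: if_splits)
      then show ?thesis using that by blast
    qed
    then have "(if v \<in> B then 1 / 2 ^ (r - v) else 1 / 2 ^ L) \<le>
        (if u \<in> B then 2 / 2 ^ (r - u) else if u = 0 then 2 / 2 ^ L else 1 / (2::real) ^ L)"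
    proof cases
      case 1
      then have "(2::real) ^ (r - u) \<le> 2 ^ Suc (r - v)"
        by (intro power_increasing) auto
      then show ?thesis using 1 by (simp add: field_simps)
    next
      case 2
      then have "(2::real) ^ (r - u) \<le> 2 ^ Suc L"
        by (intro power_increasing) (auto simp: B_def r_def)
      then show ?thesis using 2 by (simp add: field_simps)
    next
      case 3
      then have "Suc (r - v) = L" using L by (simp add: r_def)
      then have "(2::real) ^ L = 2 * 2 ^ (r - v)" by (metis power_Suc)
      then show ?thesis using 3 by (auto simp: B_def)
    qed (auto simp: field_simps)
    then show ?thesis using gain loss by simp
  qed
  obtain e where e: "(pebbling_move (spider n m L))\<^sup>*\<^sup>* d e" "1 \<le> e r"
    using solv r by (auto simp: solvable_def pebblable_def)
  have f_nonneg: "0 \<le> f v k" for v k by (simp add: f_def)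
  \<comment> \<open>A pebble on the end of the leg has weight 1, whereas the initial weight is below
    1/2 on the leg and at most 1/2 elsewhere.\<close>
  have "1 \<le> f r (e r)"
    using r e(2) by (simp add: f_def)
  also have "\<dots> \<le> (\<Sum>v<n. f v (e v))"
    using r f_nonneg by (intro member_le_sum[where f = "\<lambda>v. f v (e v)"]) auto
  also have "\<dots> \<le> (\<Sum>v<n. f v (d v))"
    using spider_edge f_step by (rule potential_pebbling_moves[OF _ _ e(1)])
  also have "\<dots> = (\<Sum>v\<in>B. f v (d v)) + (\<Sum>v\<in>{..<n} - B. f v (d v))"
    using r by (subst sum.subset_diff[of B]) (auto simp: B_def)
  also have "(\<Sum>v\<in>B. f v (d v)) = (\<Sum>j<L. real (d (r - j)) / 2 ^ j)"
    by (rule sum.reindex_bij_witness[of _ "\<lambda>j. r - j" "\<lambda>v. r - v"]) (auto simp: B_def r_def f_def)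
  also have "\<dots> < 1 / 2" using leg by (simp add: r_def)
  also have "(\<Sum>v\<in>{..<n} - B. f v (d v)) \<le> 1 / 2"
  proof -
    have "(\<Sum>v\<in>{..<n} - B. f v (d v)) = f 0 (d 0) + (\<Sum>v\<in>{0<..<n} - B. f v (d v))"
    proof -
      have "{..<n} - B = insert 0 ({0<..<n} - B)" using r by (auto simp: B_def)
      then show ?thesis by simp
    qed
    also have "\<dots> = real (d 0) / 2 ^ L + (\<Sum>v\<in>{0<..<n} - B. real (d v div 2) / 2 ^ L)"
      by (auto simp: f_def B_def intro!: sum.cong)
    also have "\<dots> \<le> real (d 0) / 2 ^ L + (\<Sum>v\<in>{0<..<n}. real (d v div 2) / 2 ^ L)"
      by (intro add_left_mono sum_mono2) auto
    also have "\<dots> = (real (d 0) + (\<Sum>v\<in>{0<..<n}. real (d v div 2))) / 2 ^ L"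
      by (simp add: add_divide_distrib sum_divide_distrib)
    also have "\<dots> \<le> (2 ^ L / 2) / 2 ^ L"
      using rest by (intro divide_right_mono) auto
    finally show ?thesis by simp
  qed
  finally show False by simp
qed

section \<open>Independent geometric variables\<close>

text \<open>\<open>X\<close> depends only on coordinates in \<open>I\<close> and \<open>Y\<close>
  only on those in \<open>J\<close>; splitting the product law into \<open>I\<close> and its
  complement in \<open>A\<close> turns the intersection into a rectangle.\<close>

lemma prob_Pi_pmf_Int:
  assumes A: "finite A" and IJ: "I \<inter> J = {}" "I \<subseteq> A" "J \<subseteq> A"
    and X: "\<And>f g. (\<And>v. v \<in> I \<Longrightarrow> f v = g v) \<Longrightarrow> f \<in> X \<longleftrightarrow> g \<in> X"
    and Y: "\<And>f g. (\<And>v. v \<in> J \<Longrightarrow> f v = g v) \<Longrightarrow> f \<in> Y \<longleftrightarrow> g \<in> Y"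
  shows "measure_pmf.prob (Pi_pmf A z p) (X \<inter> Y) =
    measure_pmf.prob (Pi_pmf A z p) X * measure_pmf.prob (Pi_pmf A z p) Y"
proof -
  let ?P = "Pi_pmf I z p" and ?Q = "Pi_pmf (A - I) z p"
  have fin: "finite I" "finite (A - I)" and un: "I \<union> (A - I) = A"
    using A IJ finite_subset by auto
  \<comment> \<open>Stated for general events, so that taking \<open>UNIV\<close> for one of them
    also evaluates the separate probabilities of \<open>X\<close> and \<open>Y\<close>.\<close>
  have eq: "measure_pmf.prob (Pi_pmf A z p) (U \<inter> V) = measure_pmf.prob ?P U * measure_pmf.prob ?Q V"
    if U: "\<And>f g. (\<And>v. v \<in> I \<Longrightarrow> f v = g v) \<Longrightarrow> f \<in> U \<longleftrightarrow> g \<in> U"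
      and V: "\<And>f g. (\<And>v. v \<in> J \<Longrightarrow> f v = g v) \<Longrightarrow> f \<in> V \<longleftrightarrow> g \<in> V" for U V
  proof -
    have "Pi_pmf A z p = map_pmf (\<lambda>(f, g) x. if x \<in> I then f x else g x) (pair_pmf ?P ?Q)"
      using Pi_pmf_union[OF fin, of z p] un by auto
    then have "measure_pmf.prob (Pi_pmf A z p) (U \<inter> V) = measure_pmf.prob (pair_pmf ?P ?Q)
        ((\<lambda>(f, g) x. if x \<in> I then f x else g x) -` (U \<inter> V))"
      by simp
    also have "(\<lambda>(f, g) x. if x \<in> I then f x else g x) -` (U \<inter> V) = U \<times> V"
    proof -
      have "(\<lambda>x. if x \<in> I then f x else g x) \<in> U \<longleftrightarrow> f \<in> U"
        "(\<lambda>x. if x \<in> I then f x else g x) \<in> V \<longleftrightarrow> g \<in> V" for f g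
        by (rule U, simp) (rule V, use IJ in auto)
      then show ?thesis by auto
    qed
    also have "measure_pmf.prob (pair_pmf ?P ?Q) (U \<times> V) = measure_pmf.prob ?P U * measure_pmf.prob ?Q V"
    proof -
      \<comment> \<open>Restricting to the supports provides the countable sets that the product
        rule needs.\<close>
      have "measure_pmf.prob (pair_pmf ?P ?Q) (U \<times> V) =
          measure_pmf.prob (pair_pmf ?P ?Q) ((U \<inter> set_pmf ?P) \<times> (V \<inter> set_pmf ?Q))"
        by (intro measure_prob_cong_0) (auto simp: pmf_pair set_pmf_iff)
      also have "\<dots> = measure_pmf.prob ?P (U \<inter> set_pmf ?P) * measure_pmf.prob ?Q (V \<inter> set_pmf ?Q)"
        by (intro measure_pmf_prob_product) auto
      finally show ?thesis by (simp add: measure_Int_set_pmf)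
    qed
    finally show ?thesis .
  qed
  show ?thesis
  proof -
    have "measure_pmf.prob (Pi_pmf A z p) (X \<inter> UNIV) = measure_pmf.prob ?P X * measure_pmf.prob ?Q UNIV"
      by (rule eq[OF X]) auto
    moreover have "measure_pmf.prob (Pi_pmf A z p) (UNIV \<inter> Y) = measure_pmf.prob ?P UNIV * measure_pmf.prob ?Q Y"
      by (rule eq[OF _ Y]) auto
    ultimately show ?thesis
      using eq[OF X Y] by simp
  qed
qed

lemma prob_Pi_pmf_blocks:
  assumes A: "finite A" and disj: "\<And>i j. i < j \<Longrightarrow> j < m \<Longrightarrow> B i \<inter> B j = {}"
    and sub: "\<And>i. i < (m::nat) \<Longrightarrow> B i \<subseteq> A"
    and X: "\<And>i f g. i < m \<Longrightarrow> (\<And>v. v \<in> B i \<Longrightarrow> f v = g v) \<Longrightarrow> f \<in> X i \<longleftrightarrow> g \<in> X i"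
  shows "measure_pmf.prob (Pi_pmf A z p) {f. \<forall>i<m. f \<in> X i} =
    (\<Prod>i<m. measure_pmf.prob (Pi_pmf A z p) (X i))"
  using disj sub X
proof (induction m)
  case (Suc m)
  have step: "{f. \<forall>i<Suc m. f \<in> X i} = {f. \<forall>i<m. f \<in> X i} \<inter> X m"
    by (auto simp: less_Suc_eq)
  have prob_Int: "measure_pmf.prob (Pi_pmf A z p) ({f. \<forall>i<m. f \<in> X i} \<inter> X m) =
      measure_pmf.prob (Pi_pmf A z p) {f. \<forall>i<m. f \<in> X i} * measure_pmf.prob (Pi_pmf A z p) (X m)"
  proof (rule prob_Pi_pmf_Int[OF A, where I = "\<Union>i<m. B i" and J = "B m"])
    show "(\<Union>i<m. B i) \<inter> B m = {}"
      using Suc.prems(1)[of _ m] by auto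
    show "(\<Union>i<m. B i) \<subseteq> A" "B m \<subseteq> A"
      using Suc.prems(2) by (meson UN_least lessThan_iff less_SucI) (use Suc.prems(2) in auto)
    show "f \<in> {f. \<forall>i<m. f \<in> X i} \<longleftrightarrow> g \<in> {f. \<forall>i<m. f \<in> X i}"
      if "\<And>v. v \<in> (\<Union>i<m. B i) \<Longrightarrow> f v = g v" for f g
    proof -
      have "f \<in> X i \<longleftrightarrow> g \<in> X i" if "i < m" for i
        using \<open>i < m\<close> \<open>\<And>v. v \<in> (\<Union>i<m. B i) \<Longrightarrow> f v = g v\<close> by (intro Suc.prems(3)) auto
      then show ?thesis by auto
    qed
    show "f \<in> X m \<longleftrightarrow> g \<in> X m" if "\<And>v. v \<in> B m \<Longrightarrow> f v = g v" for f g
      using that by (intro Suc.prems(3)) auto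
  qed
  have IH: "measure_pmf.prob (Pi_pmf A z p) {f. \<forall>i<m. f \<in> X i} =
      (\<Prod>i<m. measure_pmf.prob (Pi_pmf A z p) (X i))"
  proof (rule Suc.IH)
    show "f \<in> X i \<longleftrightarrow> g \<in> X i" if "i < m" "\<And>v. v \<in> B i \<Longrightarrow> f v = g v" for i f g
      using that by (intro Suc.prems(3)) simp_all
  qed (use Suc.prems(1,2) in simp_all)
  show ?case
    unfolding step prob_Int IH prod.lessThan_Suc ..
qed auto

section \<open>Moments, halving and tail bounds for geometric variables\<close>

lemma expectation_geom_mean:
  assumes "0 \<le> a"
  shows "integrable (geom_mean a) real" "measure_pmf.expectation (geom_mean a) real = a"
proof -
  have p: "inverse (1 + a) \<in> {0<..1}"
    using assms by (simp add: inverse_le_1_iff)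
  show "integrable (geom_mean a) real"
    unfolding geom_mean_def by (rule integrable_real_geometric_pmf[OF p])
  show "measure_pmf.expectation (geom_mean a) real = a"
    unfolding geom_mean_def expectation_geometric_pmf[OF p] using assms by (simp add: field_simps)
qed

text \<open>The probability is \<open>1 - q ^ r\<close> with \<open>1 / q = 1 + 1 / a\<close>, and
  Bernoulli's inequality gives \<open>1 / q ^ r \<ge> 1 + r / a\<close>.\<close>

lemma prob_geom_mean_lessThan:
  assumes "0 < a"
  shows "real r / (a + real r) \<le> measure_pmf.prob (geom_mean a) {..<r}"
proof -
  define q where "q = a / (1 + a)"
  have q: "0 < q" "q < 1" "1 - q = 1 / (1 + a)"
    using assms by (auto simp: q_def field_simps)
  have "measure_pmf.prob (geom_mean a) {..<r} = (\<Sum>k<r. q ^ k / (1 + a))"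
    using assms by (simp add: measure_measure_pmf_finite pmf_geom_mean q_def)
  also have "\<dots> = (1 - q) * (\<Sum>k<r. q ^ k)"
    unfolding q(3) by (simp add: sum_divide_distrib)
  also have "\<dots> = 1 - q ^ r"
    by (simp add: one_diff_power_eq)
  finally have prob: "measure_pmf.prob (geom_mean a) {..<r} = 1 - q ^ r" .
  have "1 + real r * (1 / a) \<le> (1 + 1 / a) ^ r"
    using assms by (intro Bernoulli_inequality) (simp add: order_trans[of _ 0])
  also have "(1 + 1 / a) ^ r = 1 / q ^ r"
    using assms by (simp add: q_def power_one_over[symmetric] add_divide_distrib add.commute)
  finally have "q ^ r * (1 + real r * (1 / a)) \<le> 1"
    using q by (simp add: field_simps)
  then have "q ^ r \<le> a / (a + real r)"
    using assms by (simp add: field_simps)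
  moreover have "real r / (a + real r) = 1 - a / (a + real r)"
    using assms by (simp add: field_simps)
  ultimately show ?thesis unfolding prob by simp
qed

text \<open>The probabilities of \<open>2 * k\<close> and \<open>2 * k + 1\<close> add up to a
  constant times \<open>(q\<^sup>2) ^ k\<close>, and \<open>q\<^sup>2 = c / (1 + c)\<close> for the
  new mean \<open>c\<close>.\<close>

lemma map_div2_geom_mean:
  assumes "0 \<le> a"
  shows "map_pmf (\<lambda>k. k div 2) (geom_mean a) = geom_mean (a\<^sup>2 / (1 + 2 * a))"
proof (rule pmf_eqI)
  fix k
  define q where "q = a / (1 + a)"
  define c where "c = a\<^sup>2 / (1 + 2 * a)"
  have c: "0 \<le> c" using assms by (simp add: c_def)
  have one_c: "1 + c = (1 + a)\<^sup>2 / (1 + 2 * a)"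
    using assms by (simp add: c_def field_simps power2_eq_square)
  have qc: "c / (1 + c) = q\<^sup>2"
    unfolding one_c using assms by (simp add: c_def q_def power_divide)
  have pc: "(1 + q) / (1 + a) = 1 / (1 + c)"
    unfolding one_c using assms by (simp add: q_def field_simps power2_eq_square)
  have "(\<lambda>k. k div 2) -` {k} = {2 * k, Suc (2 * k)}"
    by auto
  then have "pmf (map_pmf (\<lambda>k. k div 2) (geom_mean a)) k =
      pmf (geom_mean a) (2 * k) + pmf (geom_mean a) (Suc (2 * k))"
    by (simp add: pmf_map measure_measure_pmf_finite)
  also have "\<dots> = (q\<^sup>2) ^ k * ((1 + q) / (1 + a))"
    using assms unfolding power_mult[symmetric]
    by (simp add: pmf_geom_mean q_def[symmetric] add_divide_distrib distrib_left)
  also have "\<dots> = pmf (geom_mean c) k"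
    unfolding pc using c by (simp add: pmf_geom_mean qc)
  finally show "pmf (map_pmf (\<lambda>k. k div 2) (geom_mean a)) k = pmf (geom_mean (a\<^sup>2 / (1 + 2 * a))) k"
    by (simp add: c_def)
qed

lemma expectation_power_geom_mean:
  assumes "0 \<le> a" "0 \<le> z" "z \<le> 1"
  shows "measure_pmf.expectation (geom_mean a) (\<lambda>k. z ^ k) = 1 / (1 + a * (1 - z))"
proof -
  define q where "q = a / (1 + a)"
  have q: "0 \<le> q" "q < 1" using assms by (auto simp: q_def)
  have qz: "norm (q * z) < 1"
    using q assms mult_left_le[of z q] by (simp add: abs_mult)
  have s: "(\<lambda>k. 1 / (1 + a) * (q * z) ^ k) sums (1 / (1 + a) * (1 / (1 - q * z)))"
    using geometric_sums[OF qz] by (intro sums_mult)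
  have eq: "pmf (geom_mean a) k * z ^ k = 1 / (1 + a) * (q * z) ^ k" for k
    using assms unfolding power_mult_distrib by (simp add: pmf_geom_mean q_def)
  have "measure_pmf.expectation (geom_mean a) (\<lambda>k. z ^ k) =
        (\<integral>k. pmf (geom_mean a) k * z ^ k \<partial>count_space UNIV)"
    unfolding measure_pmf_eq_density by (subst integral_density) auto
  also have "integrable (count_space UNIV) (\<lambda>k. pmf (geom_mean a) k * z ^ k)"
    using s assms q unfolding eq integrable_count_space_nat_iff
    by (simp add: sums_iff abs_mult power_abs)
  then have "(\<integral>k. pmf (geom_mean a) k * z ^ k \<partial>count_space UNIV) = 1 / (1 + a) * (1 / (1 - q * z))"
    using s by (subst integral_count_space_nat) (simp_all add: eq sums_iff)
  also have "\<dots> = 1 / (1 + a * (1 - z))"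
  proof -
    have "(1 + a) * (1 - q * z) = 1 + a * (1 - z)"
      using assms by (simp add: q_def field_simps)
    moreover have "1 / (1 + a) * (1 / (1 - q * z)) = 1 / ((1 + a) * (1 - q * z))"
      by simp
    ultimately show ?thesis by (simp only:)
  qed
  finally show ?thesis .
qed

lemma map_pebble_pmf_component:
  "v < n \<Longrightarrow> map_pmf (\<lambda>d. d v) (pebble_pmf n a) = geom_mean a"
  by (simp add: pebble_pmf_def Pi_pmf_component)

lemma prob_weighted_sum_ge:
  fixes g :: "'i \<Rightarrow> nat \<Rightarrow> real"
  assumes w: "\<And>j. j \<in> J \<Longrightarrow> w j < n"
    and int: "\<And>j. j \<in> J \<Longrightarrow> integrable (geom_mean a) (g j)"
    and nonneg: "\<And>j k. j \<in> J \<Longrightarrow> 0 \<le> g j k" and c: "0 < c"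
  shows "measure_pmf.prob (pebble_pmf n a) {d. c \<le> (\<Sum>j\<in>J. g j (d (w j)))} \<le>
    (\<Sum>j\<in>J. measure_pmf.expectation (geom_mean a) (g j)) / c"
proof -
  have intj: "integrable (pebble_pmf n a) (\<lambda>d. g j (d (w j)))"
    and expj: "measure_pmf.expectation (pebble_pmf n a) (\<lambda>d. g j (d (w j))) =
      measure_pmf.expectation (geom_mean a) (g j)" if "j \<in> J" for j
    using int[OF that] integrable_map_pmf_eq[of "\<lambda>d. d (w j)" "pebble_pmf n a" "g j"]
      integral_map_pmf[of "\<lambda>d. d (w j)" "pebble_pmf n a" "g j"]
    by (simp_all add: map_pebble_pmf_component[OF w[OF that]])
  have "measure_pmf.prob (pebble_pmf n a) {d \<in> space (pebble_pmf n a). c \<le> (\<Sum>j\<in>J. g j (d (w j)))} \<le>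
      measure_pmf.expectation (pebble_pmf n a) (\<lambda>d. \<Sum>j\<in>J. g j (d (w j))) / c"
    using intj nonneg c
    by (intro integral_Markov_inequality_measure[where A = UNIV]) (auto intro!: sum_nonneg)
  also have "measure_pmf.expectation (pebble_pmf n a) (\<lambda>d. \<Sum>j\<in>J. g j (d (w j))) =
      (\<Sum>j\<in>J. measure_pmf.expectation (geom_mean a) (g j))"
    using intj expj by (simp add: Bochner_Integration.integral_sum)
  finally show ?thesis by simp
qed

text \<open>Chernoff's bound for the lower tail, with base \<open>z = 1 - 1 / (2 (1 + c))\<close>.\<close>

lemma prob_halves_less:
  assumes a: "0 \<le> a" and A: "A \<subseteq> {0..<n}" "8 \<le> card A" and M: "1 \<le> M"
    and c: "16 * real M \<le> real (card A) * (a\<^sup>2 / (1 + 2 * a))"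
  shows "measure_pmf.prob (pebble_pmf n a) {d. (\<Sum>v\<in>A. d v div 2) < M} \<le> 1 / 2"
proof -
  define c where "c = a\<^sup>2 / (1 + 2 * a)"
  define N where "N = real (card A)"
  define z where "z = (1 + 2 * c) / (2 * (1 + c))"
  have c0: "0 \<le> c" using a by (simp add: c_def)
  have z: "0 < z" "z \<le> 1" "1 - z = 1 / (2 * (1 + c))" "1 / z = 1 + 1 / (1 + 2 * c)"
    using c0 by (auto simp: z_def field_simps)
  have finA: "finite A" using A finite_subset by blast
  \<comment> \<open>The factor 1 off \<open>A\<close> extends the product to all vertices, where the
    expectation factorises.\<close>
  define f where "f = (\<lambda>v k. if v \<in> A then z ^ (k div 2) else (1::real))"
  have f01: "0 \<le> f v k" "f v k \<le> 1" for v k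
    using z by (auto simp: f_def power_le_one)
  have intf: "integrable (geom_mean a) (f v)" for v
    by (rule measure_pmf.integrable_const_bound[where B = 1]) (use f01 in auto)
  have prodf: "(\<Prod>v\<in>{0..<n}. f v (d v)) = z ^ (\<Sum>v\<in>A. d v div 2)" for d
  proof -
    have "(\<Prod>v\<in>{0..<n}. f v (d v)) = (\<Prod>v\<in>A. z ^ (d v div 2))"
      using A by (simp add: f_def prod.If_cases Int_absorb1)
    then show ?thesis by (simp add: power_sum)
  qed
  have expf: "measure_pmf.expectation (geom_mean a) (f v) = (if v \<in> A then 1 / (1 + c * (1 - z)) else 1)" for v
  proof (cases "v \<in> A")
    case True
    have "measure_pmf.expectation (geom_mean a) (\<lambda>k. z ^ (k div 2)) =
        measure_pmf.expectation (map_pmf (\<lambda>k. k div 2) (geom_mean a)) (\<lambda>k. z ^ k)"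
      by simp
    also have "\<dots> = 1 / (1 + c * (1 - z))"
      unfolding map_div2_geom_mean[OF a] c_def[symmetric]
      using c0 z by (intro expectation_power_geom_mean) auto
    finally show ?thesis using True by (simp add: f_def)
  qed (simp add: f_def)
  have exp: "measure_pmf.expectation (pebble_pmf n a) (\<lambda>d. \<Prod>v\<in>{0..<n}. f v (d v)) =
      (1 / (1 + c * (1 - z))) ^ card A"
  proof -
    have "measure_pmf.expectation (pebble_pmf n a) (\<lambda>d. \<Prod>v\<in>{0..<n}. f v (d v)) =
        (\<Prod>v\<in>{0..<n}. measure_pmf.expectation (geom_mean a) (f v))"
      unfolding pebble_pmf_def using intf f01 by (intro expectation_prod_Pi_pmf) auto
    also have "\<dots> = (1 / (1 + c * (1 - z))) ^ card A"
      unfolding expf using A by (simp add: prod.If_cases Int_absorb1 power_one_over)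
    finally show ?thesis .
  qed
  have zM: "(1 / z) ^ M \<le> exp (1 / (1 + 2 * c)) ^ M"
    unfolding z(4) using c0 by (intro power_mono exp_ge_add_one_self) auto
  have cA: "(1 / (1 + c * (1 - z))) ^ card A \<le> exp (- (c / (4 * (1 + c)))) ^ card A"
  proof (intro power_mono)
    define y where "y = c / (2 * (1 + c))"
    have y: "0 \<le> y" "y \<le> 1" using c0 by (auto simp: y_def field_simps)
    have "exp (y / 2) \<le> 1 + y / 2 + (y / 2)\<^sup>2"
      using y by (intro exp_bound) auto
    also have "\<dots> \<le> 1 + y"
      using y mult_left_le[of y y] by (simp add: power2_eq_square)
    finally have "exp (y / 2) \<le> 1 + y" .
    then have "1 / (1 + y) \<le> 1 / exp (y / 2)"
      by (intro divide_left_mono) (use y in auto)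
    then show "1 / (1 + c * (1 - z)) \<le> exp (- (c / (4 * (1 + c))))"
      unfolding z(3) by (simp add: y_def exp_minus inverse_eq_divide)
    show "0 \<le> 1 / (1 + c * (1 - z))" using c0 z by simp
  qed
  have "measure_pmf.prob (pebble_pmf n a) {d. (\<Sum>v\<in>A. d v div 2) < M} \<le>
      measure_pmf.prob (pebble_pmf n a) {d \<in> space (pebble_pmf n a). z ^ M \<le> (\<Prod>v\<in>{0..<n}. f v (d v))}"
    unfolding prodf using z
    by (intro measure_pmf.finite_measure_mono) (auto intro!: power_decreasing)
  also have "\<dots> \<le> (1 / (1 + c * (1 - z))) ^ card A / z ^ M"
    unfolding exp[symmetric] using z f01 intf
    by (intro integral_Markov_inequality_measure[where A = UNIV])
      (auto simp: pebble_pmf_def intro!: prod_nonneg integrable_prod_Pi_pmf)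
  also have "\<dots> = (1 / (1 + c * (1 - z))) ^ card A * (1 / z) ^ M"
    by (simp add: power_one_over)
  also have "\<dots> \<le> exp (- (c / (4 * (1 + c)))) ^ card A * exp (1 / (1 + 2 * c)) ^ M"
    using z c0 by (intro mult_mono cA zM) auto
  also have "exp (- (c / (4 * (1 + c)))) ^ card A * exp (1 / (1 + 2 * c)) ^ M =
      exp (real M / (1 + 2 * c) - N * c / (4 * (1 + c)))"
    by (simp add: exp_of_nat_mult[symmetric] exp_add[symmetric] N_def mult_ac)
  \<comment> \<open>With \<open>y = N * c / (1 + c)\<close> the exponent is at most
    \<open>y / 16 - y / 4\<close>, and \<open>y \<ge> 4\<close> because \<open>N \<ge> 8\<close> and
    \<open>N * c \<ge> 16\<close>.\<close>
  also have "\<dots> \<le> exp (- 3 / 4)"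
  proof -
    have Nc: "16 * real M \<le> N * c" using c by (simp add: c_def N_def)
    have "real M / (1 + 2 * c) \<le> real M / (1 + c)"
      using c0 by (intro divide_left_mono) auto
    also have "\<dots> \<le> (N * c / 16) / (1 + c)"
      using Nc c0 by (intro divide_right_mono) auto
    also have "\<dots> = N * c / (1 + c) / 16" by simp
    finally have 1: "real M / (1 + 2 * c) \<le> N * c / (1 + c) / 16" .
    have "4 * (1 + c) \<le> N * c"
    proof -
      have "8 * c \<le> N * c" using A c0 by (intro mult_right_mono) (auto simp: N_def)
      moreover have "16 \<le> N * c" using Nc M by linarith
      ultimately have "4 + 4 * c \<le> N * c" by linarith
      then show ?thesis by (simp add: distrib_left)
    qed
    then have 2: "4 \<le> N * c / (1 + c)" using c0 by (simp add: field_simps)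
    have "N * c / (4 * (1 + c)) = N * c / (1 + c) / 4" by simp
    moreover have "u - x \<le> - 3 / 4" if "u \<le> y / 16" "4 \<le> y" "x = y / 4" for u x y :: real
      using that by linarith
    ultimately have "real M / (1 + 2 * c) - N * c / (4 * (1 + c)) \<le> - 3 / 4"
      using 1 2 by blast
    then show ?thesis by simp
  qed
  also have "exp (- 3 / 4) \<le> (1 / 2 :: real)"
  proof -
    have "(2::real) \<le> 1 + 3/4 + (3/4)\<^sup>2 / 2" by (simp add: power2_eq_square)
    also have "\<dots> \<le> exp (3 / 4)"
      by (rule exp_lower_Taylor_quadratic) simp
    finally have "2 \<le> exp (3 / 4 :: real)" .
    then show ?thesis by (simp add: exp_minus field_simps)
  qed
  finally show ?thesis .
qed

section \<open>Solvability of random distributions on spiders\<close>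

lemma sum_half_powers_le: "(\<Sum>j\<in>{I..<L}. 1 / (2::real) ^ j) \<le> 2 / 2 ^ I"
proof (cases "I \<le> L")
  case True
  then have "(\<Sum>j\<in>{I..<L}. 1 / (2::real) ^ j) = 2 / 2 ^ I - 2 / 2 ^ L"
  proof (induction L rule: dec_induct)
    case (step L)
    then show ?case by simp
  qed simp
  then show ?thesis by simp
qed simp

text \<open>Only a lower bound for the probability that a leg is light, depending neither on the
  mean nor on the length of the leg.\<close>

definition light_leg_prob :: "nat \<Rightarrow> real" where
  "light_leg_prob I = (\<Prod>j<I. 2 ^ j / (real I * 2 ^ I)) / 2"

text \<open>The \<open>I\<close> vertices nearest to the end of the leg share a budget of \<open>1 / 4\<close> equally;
  the others contribute at least \<open>1 / 4\<close> with probability at most \<open>1 / 2\<close> by Markov's inequality.\<close>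

lemma prob_light_leg:
  assumes a: "0 < a" "a \<le> 2 ^ I / 16" and I: "1 \<le> I" and r: "r < n" "L \<le> r"
  shows "light_leg_prob I \<le>
    measure_pmf.prob (pebble_pmf n a) {d. (\<Sum>j<L. real (d (r - j)) / 2 ^ j) < 1 / 2}"
proof -
  let ?P = "measure_pmf.prob (pebble_pmf n a)"
  \<comment> \<open>The leg may be shorter than \<open>I\<close>; the surplus factors of
    \<open>light_leg_prob\<close> are at most 1.\<close>
  define k where "k = min I L"
  \<comment> \<open>With the added 1, \<open>d (r - j) < b j\<close> says that vertex
    \<open>r - j\<close> contributes at most \<open>1 / (4 * I)\<close>.\<close>
  define b where "b = (\<lambda>j. nat \<lfloor>2 ^ j / (4 * real I)\<rfloor> + 1)"
  define X where "X = {d :: nat \<Rightarrow> nat. \<forall>j<k. d \<in> {d. d (r - j) < b j}}"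
  define Y where "Y = {d :: nat \<Rightarrow> nat. (\<Sum>j\<in>{I..<L}. real (d (r - j)) / 2 ^ j) < 1 / 4}"
  have "{d. 1 / 4 \<le> (\<Sum>j\<in>{I..<L}. real (d (r - j)) / 2 ^ j)} = UNIV - Y"
    by (auto simp: Y_def)
  moreover have "?P {d. 1 / 4 \<le> (\<Sum>j\<in>{I..<L}. real (d (r - j)) / 2 ^ j)} \<le> 1 / 2"
  proof -
    have "?P {d. 1 / 4 \<le> (\<Sum>j\<in>{I..<L}. real (d (r - j)) / 2 ^ j)} \<le>
        (\<Sum>j\<in>{I..<L}. measure_pmf.expectation (geom_mean a) (\<lambda>x. real x / 2 ^ j)) / (1 / 4)"
      using r a expectation_geom_mean(1)[of a]
      by (intro prob_weighted_sum_ge[where g = "\<lambda>j x. real x / 2 ^ j"]) auto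
    also have "\<dots> = 4 * a * (\<Sum>j\<in>{I..<L}. 1 / 2 ^ j)"
      using a by (simp add: expectation_geom_mean(2) sum_distrib_left mult_ac)
    also have "\<dots> \<le> 4 * a * (2 / 2 ^ I)"
      using a by (intro mult_left_mono sum_half_powers_le) auto
    also have "\<dots> \<le> 1 / 2"
      using a by (simp add: field_simps)
    finally show ?thesis .
  qed
  ultimately have PY: "1 / 2 \<le> ?P Y"
    using measure_pmf.prob_compl[of Y "pebble_pmf n a"] by simp
  have "?P X = (\<Prod>j<k. ?P {d. d (r - j) < b j})"
    unfolding X_def pebble_pmf_def
    by (rule prob_Pi_pmf_blocks[where B = "\<lambda>j. {r - j}"]) (use r in \<open>auto simp: k_def\<close>)
  also have "\<dots> \<ge> (\<Prod>j<k. 2 ^ j / (real I * 2 ^ I))"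
  proof (intro prod_mono conjI)
    fix j assume j: "j \<in> {..<k}"
    then have "j < I" "r - j < n" using r by (auto simp: k_def)
    define y where "y = 2 ^ j / (4 * real I)"
    have y: "0 < y" "y \<le> real (b j)"
      using I by (auto simp: y_def b_def intro: order_less_imp_le) linarith
    have "(2::real) ^ Suc j \<le> 2 ^ I" using \<open>j < I\<close> by (intro power_increasing) auto
    also have "(2::real) ^ I \<le> real I * 2 ^ I" using I by simp
    finally have "y \<le> 2 ^ I / 8"
      using I by (simp add: y_def field_simps)
    \<comment> \<open>The denominator bounds \<open>a + y\<close>, as
      \<open>a \<le> 2 ^ I / 16\<close> and \<open>y \<le> 2 ^ I / 8\<close>.\<close>
    have "2 ^ j / (real I * 2 ^ I) \<le> y / (3 * 2 ^ I / 16)"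
      using I by (simp add: y_def field_simps)
    also have "\<dots> \<le> y / (a + y)"
      using \<open>y \<le> 2 ^ I / 8\<close> y a by (intro divide_left_mono) auto
    also have "\<dots> \<le> real (b j) / (a + real (b j))"
      using y a by (simp add: field_simps)
    also have "\<dots> \<le> measure_pmf.prob (geom_mean a) {..<b j}"
      using a by (intro prob_geom_mean_lessThan) auto
    also have "\<dots> = ?P {d. d (r - j) < b j}"
      unfolding map_pebble_pmf_component[OF \<open>r - j < n\<close>, of a, symmetric] by (simp add: vimage_def)
    finally show "2 ^ j / (real I * 2 ^ I) \<le> ?P {d. d (r - j) < b j}" .
  qed simp
  finally have PX: "(\<Prod>j<k. 2 ^ j / (real I * 2 ^ I)) \<le> ?P X" .
  have "(\<Prod>j<I. 2 ^ j / (real I * 2 ^ I)) =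
      (\<Prod>j<k. 2 ^ j / (real I * 2 ^ I)) * (\<Prod>j\<in>{k..<I}. 2 ^ j / (real I * 2 ^ I))"
    by (subst prod.union_disjoint[symmetric]) (auto simp: k_def ivl_disj_un intro!: prod.cong)
  also have "\<dots> \<le> (\<Prod>j<k. 2 ^ j / (real I * 2 ^ I)) * 1"
  proof (intro mult_left_mono prod_le_1)
    fix j assume "j \<in> {k..<I}"
    then have "(2::real) ^ j \<le> 2 ^ I" by (intro power_increasing) auto
    also have "\<dots> \<le> real I * 2 ^ I" using I by simp
    finally show "0 \<le> 2 ^ j / (real I * 2 ^ I) \<and> 2 ^ j / (real I * 2 ^ I) \<le> 1"
      using I by simp
  qed (auto intro!: prod_nonneg)
  finally have "light_leg_prob I \<le> ?P X * (1 / 2)"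
    using PX by (simp add: light_leg_prob_def)
  also have "\<dots> \<le> ?P X * ?P Y"
    using PY by (intro mult_left_mono) auto
  also have "\<dots> = ?P (X \<inter> Y)"
    unfolding pebble_pmf_def
  proof (rule prob_Pi_pmf_Int[symmetric, where I = "(\<lambda>j. r - j) ` {..<k}" and J = "(\<lambda>j. r - j) ` {I..<L}"])
    show "(\<lambda>j. r - j) ` {..<k} \<inter> (\<lambda>j. r - j) ` {I..<L} = {}"
      using r by (auto simp: k_def)
    show "f \<in> Y \<longleftrightarrow> g \<in> Y" if "\<And>v. v \<in> (\<lambda>j. r - j) ` {I..<L} \<Longrightarrow> f v = g v" for f g
      using that by (simp add: Y_def)
  qed (use r in \<open>auto simp: X_def\<close>)
  also have "\<dots> \<le> ?P {d. (\<Sum>j<L. real (d (r - j)) / 2 ^ j) < 1 / 2}"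
  proof (intro measure_pmf.finite_measure_mono subsetI CollectI)
    fix d assume d: "d \<in> X \<inter> Y"
    have "(\<Sum>j<L. real (d (r - j)) / 2 ^ j) =
        (\<Sum>j<k. real (d (r - j)) / 2 ^ j) + (\<Sum>j\<in>{I..<L}. real (d (r - j)) / 2 ^ j)"
      by (subst sum.union_disjoint[symmetric]) (auto simp: k_def intro!: sum.cong)
    also have "(\<Sum>j<k. real (d (r - j)) / 2 ^ j) \<le> (\<Sum>j<k. 1 / (4 * real I))"
    proof (rule sum_mono)
      fix j assume "j \<in> {..<k}"
      then have "d (r - j) \<le> nat \<lfloor>2 ^ j / (4 * real I)\<rfloor>"
        using d by (auto simp: X_def b_def less_Suc_eq_le)
      then have "real (d (r - j)) \<le> real (nat \<lfloor>2 ^ j / (4 * real I)\<rfloor>)"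
        by (rule of_nat_mono)
      also have "\<dots> \<le> 2 ^ j / (4 * real I)"
        by (rule of_nat_floor) simp
      finally show "real (d (r - j)) / 2 ^ j \<le> 1 / (4 * real I)"
        by (simp add: field_simps)
    qed
    also have "\<dots> \<le> 1 / 4"
      using I by (simp add: k_def field_simps)
    also have "(\<Sum>j\<in>{I..<L}. real (d (r - j)) / 2 ^ j) < 1 / 4"
      using d by (simp add: Y_def)
    finally show "(\<Sum>j<L. real (d (r - j)) / 2 ^ j) < 1 / 2" by simp
  qed simp
  finally show ?thesis .
qed

text \<open>The legs occupy disjoint blocks of vertices, so their weights are independent.\<close>

lemma prob_all_legs_heavy:
  assumes a: "0 < a" "a \<le> 2 ^ I / 16" and I: "1 \<le> I" and n: "m * L < n"
  shows "measure_pmf.prob (pebble_pmf n a)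
      {d. \<forall>i<m. \<not> (\<Sum>j<L. real (d (Suc i * L - j)) / 2 ^ j) < 1 / 2} \<le> (1 - light_leg_prob I) ^ m"
proof -
  let ?P = "measure_pmf.prob (pebble_pmf n a)"
  define X where "X = (\<lambda>i. {d :: nat \<Rightarrow> nat. \<not> (\<Sum>j<L. real (d (Suc i * L - j)) / 2 ^ j) < 1 / 2})"
  have le: "Suc i * L \<le> m * L" if "i < m" for i
    using that by (intro mult_right_mono) auto
  have "?P {d. \<forall>i<m. d \<in> X i} = (\<Prod>i<m. ?P (X i))"
    unfolding pebble_pmf_def
  proof (rule prob_Pi_pmf_blocks[where B = "\<lambda>i. {i * L <.. Suc i * L}"])
    show "{i * L <.. Suc i * L} \<inter> {j * L <.. Suc j * L} = {}" if "i < j" "j < m" for i j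
    proof -
      have "Suc i * L \<le> j * L" using that by (intro mult_right_mono) auto
      then show ?thesis by auto
    qed
    show "{i * L <.. Suc i * L} \<subseteq> {0..<n}" if "i < m" for i
      using le[OF that] n by auto
    show "f \<in> X i \<longleftrightarrow> g \<in> X i" if fg: "\<And>v. v \<in> {i * L <.. Suc i * L} \<Longrightarrow> f v = g v" for i f g
    proof -
      have "f (Suc i * L - j) = g (Suc i * L - j)" if "j < L" for j
        using that by (intro fg) auto
      then show ?thesis by (simp add: X_def)
    qed
  qed simp
  also have "\<dots> \<le> (\<Prod>i<m. 1 - light_leg_prob I)"
  proof (intro prod_mono conjI)
    fix i assume "i \<in> {..<m}"
    then have "Suc i * L < n" using le n by fastforce
    then have "light_leg_prob I \<le> ?P {d. (\<Sum>j<L. real (d (Suc i * L - j)) / 2 ^ j) < 1 / 2}"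
      by (intro prob_light_leg a I) auto
    moreover have "X i = UNIV - {d. (\<Sum>j<L. real (d (Suc i * L - j)) / 2 ^ j) < 1 / 2}"
      by (auto simp: X_def)
    ultimately show "?P (X i) \<le> 1 - light_leg_prob I"
      using measure_pmf.prob_compl[of _ "pebble_pmf n a"] by simp
  qed simp
  finally show ?thesis by (simp add: X_def)
qed

text \<open>Solvability forces either all legs to be heavy or a weight of at least
  \<open>2 ^ L / 2\<close> at the centre. The former has probability at most
  \<open>exp (- 2)\<close>, the latter at most 1/4 by Markov's inequality.\<close>

lemma prob_spider_solvable_le:
  assumes a: "0 < a" "a \<le> 2 ^ I / 16" and I: "1 \<le> I" and L: "1 \<le> L" and n: "m * L < n"
    and mean: "a + real n * (a\<^sup>2 / (1 + 2 * a)) \<le> 2 ^ L / 8"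
    and legs: "2 \<le> real m * light_leg_prob I"
  shows "measure_pmf.prob (pebble_pmf n a) {d. solvable (spider n m L) n d} \<le> 1 / 2"
proof -
  let ?P = "measure_pmf.prob (pebble_pmf n a)"
  define c where "c = a\<^sup>2 / (1 + 2 * a)"
  define g where "g = (\<lambda>(v::nat) k. if v = 0 then real k else real (k div 2))"
  define X where "X = {d :: nat \<Rightarrow> nat. \<forall>i<m. \<not> (\<Sum>j<L. real (d (Suc i * L - j)) / 2 ^ j) < 1 / 2}"
  define Y where "Y = {d :: nat \<Rightarrow> nat. 2 ^ L / 2 \<le> (\<Sum>v\<in>{0..<n}. g v (d v))}"
  have c0: "0 \<le> c" using a by (simp add: c_def)
  have g: "integrable (geom_mean a) (g v)"
    "measure_pmf.expectation (geom_mean a) (g v) = (if v = 0 then a else c)" for v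
  proof -
    have "integrable (map_pmf (\<lambda>k. k div 2) (geom_mean a)) real"
      "measure_pmf.expectation (map_pmf (\<lambda>k. k div 2) (geom_mean a)) real = c"
      using a c0 expectation_geom_mean[of c] by (simp_all add: map_div2_geom_mean c_def)
    then show "integrable (geom_mean a) (g v)"
      "measure_pmf.expectation (geom_mean a) (g v) = (if v = 0 then a else c)"
      using a expectation_geom_mean[of a] by (cases "v = 0"; simp add: g_def)+
  qed
  have "?P Y \<le> (\<Sum>v\<in>{0..<n}. measure_pmf.expectation (geom_mean a) (g v)) / (2 ^ L / 2)"
    unfolding Y_def using g(1) by (intro prob_weighted_sum_ge) (auto simp: g_def)
  also have "\<dots> \<le> (2 ^ L / 8) / (2 ^ L / 2)"
  proof (intro divide_right_mono)
    have "(\<Sum>v\<in>{0..<n}. measure_pmf.expectation (geom_mean a) (g v)) \<le>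
        (\<Sum>v\<in>{0..<n}. (if v = 0 then a else 0) + c)"
      unfolding g(2) using c0 by (intro sum_mono) auto
    also have "\<dots> = a + real n * c"
      using n by (simp add: sum.distrib)
    finally show "(\<Sum>v\<in>{0..<n}. measure_pmf.expectation (geom_mean a) (g v)) \<le> 2 ^ L / 8"
      using mean unfolding c_def by linarith
  qed simp
  finally have PY: "?P Y \<le> 1 / 4" by simp
  have "?P X \<le> (1 - light_leg_prob I) ^ m"
    unfolding X_def by (rule prob_all_legs_heavy[OF a I n])
  also have "\<dots> \<le> exp (- light_leg_prob I) ^ m"
  proof (intro power_mono)
    show "1 - light_leg_prob I \<le> exp (- light_leg_prob I)"
      using exp_ge_add_one_self[of "- light_leg_prob I"] by simp
    \<comment> \<open>Taking a leg of length 0 shows that the bound lies below a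
      probability.\<close>
    have "light_leg_prob I \<le> 1"
      using prob_light_leg[OF a I, of 0 n 0] n measure_pmf.prob_le_1[of "pebble_pmf n a"]
      by fastforce
    then show "0 \<le> 1 - light_leg_prob I" by simp
  qed
  also have "\<dots> = exp (- (real m * light_leg_prob I))"
    by (simp add: exp_of_nat_mult[symmetric])
  also have "\<dots> \<le> exp (- 2)" using legs by simp
  also have "\<dots> \<le> 1 / 4"
  proof -
    have "(4::real) \<le> 1 + 2 + 2\<^sup>2 / 2" by simp
    also have "\<dots> \<le> exp 2" by (rule exp_lower_Taylor_quadratic) simp
    finally have "4 \<le> exp (2::real)" .
    then show ?thesis by (simp add: exp_minus field_simps)
  qed
  finally have PX: "?P X \<le> 1 / 4" .
  have "{d. solvable (spider n m L) n d} \<subseteq> X \<union> Y"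
  proof
    fix d assume d: "d \<in> {d. solvable (spider n m L) n d}"
    show "d \<in> X \<union> Y"
    proof (rule ccontr)
      assume "d \<notin> X \<union> Y"
      then obtain i where i: "i < m" "(\<Sum>j<L. real (d (Suc i * L - j)) / 2 ^ j) < 1 / 2"
        and Y: "(\<Sum>v\<in>{0..<n}. g v (d v)) < 2 ^ L / 2"
        by (auto simp: X_def Y_def)
      have "{0..<n} = insert 0 {0<..<n}" using n by auto
      then have "(\<Sum>v\<in>{0..<n}. g v (d v)) = real (d 0) + (\<Sum>v\<in>{0<..<n}. real (d v div 2))"
        by (simp add: g_def)
      with Y show False
        using spider_not_solvable[OF L i(1) n i(2)] d by simp
    qed
  qed
  then have "?P {d. solvable (spider n m L) n d} \<le> ?P (X \<union> Y)"
    by (intro measure_pmf.finite_measure_mono) auto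
  also have "\<dots> \<le> ?P X + ?P Y"
    by (intro measure_Un_le) auto
  finally show ?thesis using PX PY by simp
qed

lemma prob_spider_solvable_ge:
  assumes a: "0 \<le> a" and L: "1 \<le> L" and n: "m * L + 9 \<le> n"
    and mean: "16 * 2 ^ L \<le> real (n - 1 - m * L) * (a\<^sup>2 / (1 + 2 * a))"
  shows "1 / 2 \<le> measure_pmf.prob (pebble_pmf n a) {d. solvable (spider n m L) n d}"
proof -
  let ?P = "measure_pmf.prob (pebble_pmf n a)"
  have card: "card {m * L <..< n} = n - 1 - m * L" by simp
  have "?P {d. (\<Sum>v\<in>{m * L <..< n}. d v div 2) < 2 ^ L} \<le> 1 / 2"
    using n mean by (intro prob_halves_less a) (auto simp: card)
  moreover have "UNIV - {d. solvable (spider n m L) n d} \<subseteq>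
      {d. (\<Sum>v\<in>{m * L <..< n}. d v div 2) < 2 ^ L}"
  proof (intro subsetI CollectI)
    fix d assume "d \<in> UNIV - {d. solvable (spider n m L) n d}"
    then have "\<not> 2 ^ L \<le> d 0 + (\<Sum>v\<in>{m * L <..< n}. d v div 2)"
      using spider_solvable[OF L] by blast
    then show "(\<Sum>v\<in>{m * L <..< n}. d v div 2) < 2 ^ L" by linarith
  qed
  then have "?P (UNIV - {d. solvable (spider n m L) n d}) \<le>
      ?P {d. (\<Sum>v\<in>{m * L <..< n}. d v div 2) < 2 ^ L}"
    by (intro measure_pmf.finite_measure_mono) auto
  ultimately show ?thesis
    using measure_pmf.prob_compl[of "{d. solvable (spider n m L) n d}" "pebble_pmf n a"] by simp
qed

text \<open>Holds for every graph and serves small \<open>n\<close>. At mean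
  \<open>1 / (2 * n)\<close> there is no pebble at all with probability at least 1/2; at mean
  \<open>2 * n\<close> a union bound leaves no vertex empty with probability at least 1/2.\<close>

lemma geom_threshold_crude:
  assumes n: "0 < n"
  shows "1 / 2 \<le> geom_threshold E n" "geom_threshold E n \<le> 2 * (real n)\<^sup>2"
proof -
  let ?S = "{d. solvable E n d}"
  define a where "a = 1 / (2 * real n)"
  have a: "0 < a" using n by (simp add: a_def)
  have low: "measure_pmf.prob (pebble_pmf n a) ?S \<le> 1 / 2"
  proof -
    have "1 / 2 = 1 + real n * (- a)" using n by (simp add: a_def)
    also have "\<dots> \<le> (1 + (- a)) ^ n"
      using n by (intro Bernoulli_inequality) (simp add: a_def)
    also have "\<dots> \<le> (1 / (1 + a)) ^ n"
      using n a by (intro power_mono) (auto simp: field_simps a_def)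
    also have "\<dots> = pmf (pebble_pmf n a) (\<lambda>_. 0)"
      using a by (simp add: pebble_pmf_def pmf_Pi' pmf_geom_mean)
    also have "\<dots> \<le> measure_pmf.prob (pebble_pmf n a) (UNIV - ?S)"
      unfolding measure_pmf_single[symmetric] using not_solvable_zero[OF n]
      by (intro measure_pmf.finite_measure_mono) auto
    finally show ?thesis
      using measure_pmf.prob_compl[of ?S "pebble_pmf n a"] by simp
  qed
  define b where "b = 2 * real n"
  have b: "0 < b" using n by (simp add: b_def)
  have high: "1 / 2 \<le> measure_pmf.prob (pebble_pmf n b) ?S"
  proof -
    have "UNIV - ?S \<subseteq> (\<Union>v\<in>{0..<n}. {d. d v = 0})"
    proof
      fix d assume "d \<in> UNIV - ?S"
      then obtain v where "v < n" "\<not> 1 \<le> d v"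
        using solvable_if_pos[of n d E] by blast
      then have "d v = 0" by simp
      then show "d \<in> (\<Union>v\<in>{0..<n}. {d. d v = 0})" using \<open>v < n\<close> by auto
    qed
    then have "measure_pmf.prob (pebble_pmf n b) (UNIV - ?S) \<le>
        measure_pmf.prob (pebble_pmf n b) (\<Union>v\<in>{0..<n}. {d. d v = 0})"
      by (intro measure_pmf.finite_measure_mono) auto
    also have "\<dots> \<le> (\<Sum>v\<in>{0..<n}. measure_pmf.prob (pebble_pmf n b) {d. d v = 0})"
      by (intro measure_pmf.finite_measure_subadditive_finite) auto
    also have "\<dots> = (\<Sum>v\<in>{0..<n}. 1 / (1 + b))"
    proof (rule sum.cong)
      fix v assume "v \<in> {0..<n}"
      then have "v < n" by simp
      have "measure_pmf.prob (pebble_pmf n b) {d. d v = 0} =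
          pmf (map_pmf (\<lambda>d. d v) (pebble_pmf n b)) 0"
        by (simp add: pmf_map vimage_def)
      also have "\<dots> = 1 / (1 + b)"
        unfolding map_pebble_pmf_component[OF \<open>v < n\<close>] using b by (simp add: pmf_geom_mean)
      finally show "measure_pmf.prob (pebble_pmf n b) {d. d v = 0} = 1 / (1 + b)" .
    qed simp
    also have "\<dots> \<le> 1 / 2"
      using n by (simp add: b_def field_simps)
    finally show ?thesis
      using measure_pmf.prob_compl[of ?S "pebble_pmf n b"] by simp
  qed
  have "(1::real) \<le> (real n)\<^sup>2" using n by simp
  then have "(1 / 2 :: real) \<le> 2 * (real n)\<^sup>2" by linarith
  moreover have "1 / 2 / real n = a" "2 * (real n)\<^sup>2 / real n = b"
    using n by (auto simp: a_def b_def power2_eq_square)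
  ultimately show "1 / 2 \<le> geom_threshold E n" "geom_threshold E n \<le> 2 * (real n)\<^sup>2"
    using geom_threshold_between[OF n, of "1 / 2" "2 * (real n)\<^sup>2" E] low high by simp_all
qed

section \<open>Choice of the spider\<close>

lemma light_leg_prob_eq:
  assumes "1 \<le> I"
  shows "light_leg_prob I = 2 powr (- (real I * (real I + 1) / 2 + real I * log 2 (real I))) / 2"
proof -
  have factor: "2 ^ j / (real I * 2 ^ I) = 2 powr (real j - real I - log 2 (real I))" for j
    using assms by (simp add: powr_diff powr_realpow)
  \<comment> \<open>The number of factors is separated from the fixed \<open>I\<close> to permit
    induction.\<close>
  have prod: "(\<Prod>j<k. 2 powr (real j - real I - log 2 (real I))) =
      2 powr (real k * (real k - 1) / 2 - real k * real I - real k * log 2 (real I))" for k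
    by (induction k) (simp_all add: powr_add[symmetric] field_simps)
  have "real I * (real I - 1) / 2 - real I * real I - real I * log 2 (real I) =
      - (real I * (real I + 1) / 2 + real I * log 2 (real I))"
    by argo
  then show ?thesis
    unfolding light_leg_prob_def factor prod by (simp only:)
qed

lemma square_le_two_powr:
  fixes x :: real
  assumes "0 \<le> x"
  shows "2 * x\<^sup>2 / 9 \<le> 2 powr x"
proof -
  have "2 * x\<^sup>2 / 9 = (x * (2 / 3))\<^sup>2 / 2"
    by (simp add: power2_eq_square)
  also have "\<dots> \<le> (x * ln 2)\<^sup>2 / 2"
    using assms ln2_ge_two_thirds by (intro divide_right_mono power_mono mult_left_mono) auto
  also have "\<dots> \<le> 1 + x * ln 2 + (x * ln 2)\<^sup>2 / 2"
    using assms by simp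
  also have "\<dots> \<le> exp (x * ln 2)"
    using assms by (intro exp_lower_Taylor_quadratic) simp
  finally show ?thesis by (simp add: powr_def)
qed

text \<open>Since \<open>\<Sum>j<I. (I - j) = I (I + 1) / 2\<close>, a leg is light with probability about
  \<open>2 powr (- I\<^sup>2 / 2 - I log I)\<close>. For \<open>I = s - log s - O(1)\<close>, where \<open>s\<^sup>2 = 2 log n\<close>, the exponent
  is \<open>- log n + \<Omega>(s)\<close>; this is where the upper end of the range of \<open>t\<close> comes from.\<close>

lemma exists_leg_scale:
  fixes a :: real
  assumes n: "2 ^ 20 \<le> real n" and a: "0 < a"
    and le: "2 ^ 16 * a \<le> 2 powr (sqrt (2 * log 2 (real n))) / sqrt (log 2 (real n))"
    and m: "real n / (8 * log 2 (real n)) \<le> real m"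
  shows "\<exists>I\<ge>1. a \<le> 2 ^ I / 16 \<and> 2 \<le> real m * light_leg_prob I"
proof -
  define l where "l = log 2 (real n)"
  define s where "s = sqrt (2 * l)"
  define u where "u = log 2 s"
  have n0: "0 < real n" by (rule less_le_trans[OF _ n]) simp
  have l: "20 \<le> l"
    using n n0 by (simp add: l_def le_log_iff powr_realpow)
  have n_l: "real n = 2 powr l" using n0 by (simp add: l_def)
  have s2: "s\<^sup>2 = 2 * l" using l by (simp add: s_def)
  have s: "6.32 \<le> s"
    unfolding s_def using l by (intro real_le_rsqrt) (simp add: power2_eq_square)
  have u0: "0 \<le> u" using s by (simp add: u_def)
  define I where "I = max 1 (nat \<lceil>log 2 (16 * a)\<rceil>)"
  have I1: "1 \<le> I" by (simp add: I_def)
  have "log 2 (16 * a) \<le> real I" by (simp add: I_def) linarith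
  then have "16 * a \<le> 2 powr real I" using a by (simp add: log_le_iff)
  then have aI: "a \<le> 2 ^ I / 16" by (simp add: powr_realpow)
  define e where "e = real I * (real I + 1) / 2 + real I * log 2 (real I)"
  \<comment> \<open>The gain \<open>3 * s\<close> pays for the factor \<open>8 * l\<close> lost in
    the number of legs, since \<open>2 powr (3 * s)\<close> exceeds a multiple of
    \<open>s\<^sup>2 = 2 * l\<close>.\<close>
  have "e \<le> l - 3 * s"
  proof (cases "I = 1")
    case True
    have "6.32 * (s - 6.32) \<le> s * (s - 6.32)" using s by (intro mult_right_mono) auto
    then have "1 \<le> l - 3 * s" using s s2 by (simp add: power2_eq_square algebra_simps)
    then show ?thesis using True by (simp add: e_def)
  next
    case False
    then have "I = nat \<lceil>log 2 (16 * a)\<rceil>" by (simp add: I_def max_def split: if_splits)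
    then have "real I \<le> log 2 (16 * a) + 1" using I1 by linarith
    also have "log 2 (16 * a) \<le> log 2 (2 powr (s - 12) / sqrt l)"
    proof -
      have "16 * a = 2 ^ 16 * a / 2 powr 12" by simp
      also have "\<dots> \<le> (2 powr s / sqrt l) / 2 powr 12"
        using le by (intro divide_right_mono) (auto simp: s_def l_def)
      also have "\<dots> = 2 powr (s - 12) / sqrt l" by (simp add: powr_diff)
      finally show ?thesis using a l by simp
    qed
    also have "\<dots> = s - 12 - log 2 (sqrt l)"
      using l by (simp add: log_divide)
    also have "log 2 (sqrt l) = u - 1 / 2"
    proof -
      have "s = sqrt 2 * sqrt l" by (simp add: s_def real_sqrt_mult)
      then have "u = log 2 (sqrt 2) + log 2 (sqrt l)"
        using l by (simp add: u_def log_mult)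
      moreover have "log 2 (sqrt 2) = (1 / 2 :: real)"
        by (simp add: powr_half_sqrt[symmetric])
      ultimately show ?thesis by simp
    qed
    \<comment> \<open>Of the factor \<open>2 ^ 16\<close>, \<open>2 ^ 4\<close> is used by
      \<open>16 * a\<close>; rounding up costs 1 and \<open>log 2 (sqrt l) = u - 1 / 2\<close>
      another 1/2, leaving 10.5.\<close>
    finally have Iu: "real I \<le> s - u - 10.5" by simp
    then have "real I \<le> s" using u0 by simp
    then have "log 2 (real I) \<le> u" using I1 by (simp add: u_def)
    then have "e \<le> real I * (real I + 1) / 2 + real I * u"
      by (simp add: e_def mult_left_mono)
    also have "\<dots> = real I * (real I + 1 + 2 * u) / 2" by (simp add: field_simps)
    \<comment> \<open>The \<open>- u\<close> in the bound on \<open>I\<close>, due to the divisor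
      \<open>sqrt l\<close>, balances the \<open>2 * u\<close> from \<open>I * log I\<close>: a
      difference of squares remains.\<close>
    also have "\<dots> \<le> (s - u - 9.5) * (s + u - 9.5) / 2"
      using Iu u0 by (intro divide_right_mono mult_mono) auto
    also have "\<dots> = ((s - 9.5)\<^sup>2 - u\<^sup>2) / 2"
    proof -
      have "s - u - 9.5 = s - 9.5 - u" "s + u - 9.5 = s - 9.5 + u" by simp_all
      moreover have "(x - u) * (x + u) = x\<^sup>2 - u\<^sup>2" for x
        by (simp add: power2_eq_square algebra_simps)
      ultimately show ?thesis by (simp only:)
    qed
    also have "\<dots> \<le> (s - 9.5)\<^sup>2 / 2" by simp
    also have "\<dots> = l - 9.5 * s + 9.5 * 9.5 / 2"
      using s2 power2_diff[of s "9.5"] by (simp add: power2_eq_square)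
    \<comment> \<open>From \<open>1 \<le> I \<le> s - u - 10.5\<close> follows
      \<open>s \<ge> 11.5\<close>, enough for \<open>6.5 * s\<close> to absorb the constant.\<close>
    also have "\<dots> \<le> l - 3 * s"
      using Iu I1 u0 by simp
    finally show ?thesis .
  qed
  then have "4 * 2 powr e \<le> 4 * 2 powr (l - 3 * s)" by simp
  also have "\<dots> = 4 * real n / 2 powr (3 * s)"
    by (simp add: powr_diff n_l)
  also have "\<dots> \<le> 4 * real n / (16 * s\<^sup>2)"
  proof (intro divide_left_mono)
    have "6.32 * s \<le> s * s" using s by (intro mult_right_mono) auto
    then have "s \<le> 2 powr s"
      using square_le_two_powr[of s] s unfolding power2_eq_square by linarith
    moreover have "(2::real) powr 4 \<le> 2 powr s" using s by (intro powr_mono) auto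
    then have "16 \<le> 2 powr s" by simp
    ultimately have "16 * (s * s) \<le> 2 powr s * (2 powr s * 2 powr s)"
      using s by (intro mult_mono) auto
    then show "16 * s\<^sup>2 \<le> 2 powr (3 * s)"
      by (simp add: powr_add[symmetric] power2_eq_square)
  qed (use s in auto)
  also have "\<dots> = real n / (8 * l)" using s2 by simp
  also have "\<dots> \<le> real m" using m by (simp add: l_def)
  finally have "4 * 2 powr e \<le> real m" .
  then have "2 \<le> real m * light_leg_prob I"
    unfolding light_leg_prob_eq[OF I1] e_def[symmetric]
    by (simp add: powr_minus field_simps)
  then show ?thesis using I1 aI by blast
qed

lemma exists_spider_threshold:
  fixes t :: real
  assumes n: "2 ^ 20 \<le> real n" and t: "sqrt (real n) \<le> t"
    "t \<le> 2 powr (sqrt (2 * log 2 (real n))) / sqrt (log 2 (real n)) * real n"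
  shows "\<exists>m L. 1 \<le> L \<and> t / 2 ^ 16 \<le> geom_threshold (spider n m L) n \<and>
    geom_threshold (spider n m L) n \<le> 2 ^ 16 * t"
proof -
  define l where "l = log 2 (real n)"
  define s where "s = sqrt (2 * l)"
  define a where "a = t / real n"
  \<comment> \<open>The mean number of pairs on a vertex. Scaling the argument up by
    \<open>2 ^ 16\<close> scales \<open>h\<close> up by at least as much.\<close>
  define h where "h = (\<lambda>x::real. x\<^sup>2 / (1 + 2 * x))"
  have n0: "0 < real n" by (rule less_le_trans[OF _ n]) simp
  have t0: "0 < t" using t(1) n0 by (meson less_le_trans real_sqrt_gt_zero)
  have a0: "0 < a" using t0 n0 by (simp add: a_def)
  have l: "20 \<le> l"
    using n n0 by (simp add: l_def le_log_iff powr_realpow)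
  have n_l: "real n = 2 powr l" using n0 by (simp add: l_def)
  have t_le: "t \<le> 2 powr s / sqrt l * real n"
    using t(2) by (simp add: s_def l_def)
  have h_scale_up: "2 ^ 16 * h a \<le> h (2 ^ 16 * a)"
    using a0 by (simp add: h_def field_simps power2_eq_square)
  have h_scale_down: "h (a / 2 ^ 16) \<le> h a / 2 ^ 16"
    using a0 by (simp add: h_def field_simps power2_eq_square)
  have h0: "0 < h a" using a0 by (simp add: h_def)
  have h_le: "h a \<le> a / 2"
    using a0 by (simp add: h_def field_simps power2_eq_square)
  have h_ge: "a / 3 \<le> h a" if "1 \<le> a"
    using that by (simp add: h_def field_simps power2_eq_square)
  \<comment> \<open>Here the lower end of the range of \<open>t\<close> enters, as
    \<open>n * a\<^sup>2 = t\<^sup>2 / n \<ge> 1\<close>. It keeps \<open>2 ^ L\<close> comparable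
    to \<open>n * h a\<close> even when \<open>L = 1\<close>.\<close>
  have nh: "1 / 3 \<le> real n * h a"
  proof (cases "1 \<le> a")
    case True
    have "1 * (1 / 3) \<le> real n * h a"
      using h_ge True n by (intro mult_mono) auto
    then show ?thesis by simp
  next
    case False
    have "real n \<le> t\<^sup>2"
      using t(1) n0 t0 by (metis real_sqrt_le_iff real_sqrt_unique abs_of_pos real_sqrt_abs order_less_imp_le)
    then have "1 \<le> real n * a\<^sup>2"
      using n0 by (simp add: a_def power_divide power2_eq_square)
    also have "real n * a\<^sup>2 \<le> real n * (3 * h a)"
      using False a0 n0 by (simp add: h_def field_simps)
    finally show ?thesis by simp
  qed
  define L where "L = (LEAST k. 1 \<le> k \<and> real n * h a \<le> 2 ^ k)"
  obtain k where "real n * h a < 2 ^ k"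
    using real_arch_pow[of 2 "real n * h a"] by auto
  moreover have "(2::real) ^ k \<le> 2 ^ Suc k" by simp
  ultimately have "1 \<le> Suc k \<and> real n * h a \<le> 2 ^ Suc k" by linarith
  then have L: "1 \<le> L" "real n * h a \<le> 2 ^ L"
    unfolding L_def by (metis (mono_tags, lifting) LeastI)+
  have L_up: "2 ^ L \<le> 6 * (real n * h a)"
  proof (cases "L = 1")
    case False
    then obtain k where k: "L = Suc k" "1 \<le> k" using L by (cases L) auto
    then have "\<not> (1 \<le> k \<and> real n * h a \<le> 2 ^ k)"
      using not_less_Least[of k] unfolding L_def by (metis (mono_tags, lifting) lessI)
    then show ?thesis using k nh by simp
  qed (use nh in simp)
  have "log 2 (2 ^ L) \<le> log 2 (real n * 2 powr s)"
  proof -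
    have "(2::real) ^ L \<le> 3 * t"
      using L_up h_le n0 by (simp add: a_def field_simps)
    also have "\<dots> \<le> 3 * (2 powr s / sqrt l * real n)"
      using t_le by simp
    also have "\<dots> = real n * (2 powr s * (3 / sqrt l))" by simp
    also have "\<dots> \<le> real n * (2 powr s * 1)"
    proof (intro mult_left_mono)
      have "sqrt 9 \<le> sqrt l" using l by (intro real_sqrt_le_mono) simp
      then show "3 / sqrt l \<le> 1" using l by simp
    qed (use n0 in auto)
    finally have "2 ^ L \<le> real n * 2 powr s" by simp
    then show ?thesis using n0 by (subst log_le_cancel_iff) auto
  qed
  then have "real L \<le> l + s"
    using n0 by (simp add: log_mult l_def[symmetric])
  moreover have "s \<le> l"
    unfolding s_def using l by (intro real_le_lsqrt) (auto simp: power2_eq_square)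
  ultimately have L_l: "real L \<le> 2 * l" by simp
  have "18 * l \<le> l * l" using l by (intro mult_right_mono) auto
  then have l_n: "4 * l \<le> real n"
    using square_le_two_powr[of l] l unfolding n_l power2_eq_square by linarith
  \<comment> \<open>The legs take up at most half of the vertices; \<open>L \<le> 2 * l\<close>
    makes them numerous enough.\<close>
  define m where "m = n div (2 * L)"
  have mL: "2 * (m * L) \<le> n"
    using div_times_less_eq_dividend[of n "2 * L"] by (simp add: m_def mult_ac)
  have m: "real n / (8 * l) \<le> real m"
  proof -
    have "1 \<le> m"
    proof -
      have "2 * L \<le> n" using L_l l_n by linarith
      then show ?thesis using L by (simp add: m_def div_greater_zero_iff Suc_le_eq)
    qed
    have "n < (m + 1) * (2 * L)"
      using dividend_less_div_times[of "2 * L" n] L by (simp add: m_def)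
    then have "real n < real ((m + 1) * (2 * L))" by (rule of_nat_less_iff[THEN iffD2])
    also have "\<dots> = (real m + 1) * (2 * real L)" by (simp add: distrib_right)
    also have "\<dots> \<le> (2 * real m) * (2 * (2 * l))"
      using L_l \<open>1 \<le> m\<close> by (intro mult_mono) auto
    finally show ?thesis using l by (simp add: field_simps)
  qed
  have "0 < a / 2 ^ 16" using a0 by simp
  moreover have "2 ^ 16 * (a / 2 ^ 16) \<le> 2 powr (sqrt (2 * log 2 (real n))) / sqrt (log 2 (real n))"
    using t(2) n0 by (simp add: a_def field_simps)
  ultimately obtain I where I: "1 \<le> I" "a / 2 ^ 16 \<le> 2 ^ I / 16" "2 \<le> real m * light_leg_prob I"
    using exists_leg_scale[OF n] m unfolding l_def by blast
  have low: "measure_pmf.prob (pebble_pmf n (t / 2 ^ 16 / real n)) {d. solvable (spider n m L) n d} \<le> 1 / 2"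
  proof -
    have "a \<le> 2 ^ L"
    proof (cases "1 \<le> a")
      case True
      have "a \<le> 3 * h a" using h_ge[OF True] by simp
      also have "\<dots> \<le> real n * h a" using n h0 by (intro mult_right_mono) auto
      finally show ?thesis using L by simp
    next
      case False
      moreover have "(1::real) \<le> 2 ^ L" by simp
      ultimately show ?thesis by linarith
    qed
    moreover have "real n * h (a / 2 ^ 16) \<le> 2 ^ L / 2 ^ 16"
    proof -
      have "real n * h (a / 2 ^ 16) \<le> real n * (h a / 2 ^ 16)"
        using h_scale_down by (intro mult_left_mono) auto
      also have "\<dots> = real n * h a / 2 ^ 16" by simp
      also have "\<dots> \<le> 2 ^ L / 2 ^ 16" using L by (intro divide_right_mono) auto
      finally show ?thesis .
    qed
    moreover have "x / 2 ^ 16 + y \<le> z / 8" if "x \<le> z" "y \<le> z / 2 ^ 16" "0 \<le> z" for x y z :: real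
      using that by simp
    moreover have "(0::real) \<le> 2 ^ L" by simp
    ultimately have "a / 2 ^ 16 + real n * h (a / 2 ^ 16) \<le> 2 ^ L / 8" by blast
    moreover have "m * L < n" using mL n by simp
    ultimately have "measure_pmf.prob (pebble_pmf n (a / 2 ^ 16)) {d. solvable (spider n m L) n d} \<le> 1 / 2"
      using a0 I L unfolding h_def by (intro prob_spider_solvable_le[where I = I]) auto
    then show ?thesis by (simp add: a_def mult.commute)
  qed
  have high: "1 / 2 \<le> measure_pmf.prob (pebble_pmf n (2 ^ 16 * t / real n)) {d. solvable (spider n m L) n d}"
  proof -
    have nn: "2 ^ 20 \<le> n" using n by simp
    \<comment> \<open>At least a quarter of the vertices are pendant at the centre.\<close>
    then have "n \<le> 4 * (n - 1 - m * L)" using mL by simp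
    then have "real n \<le> real (4 * (n - 1 - m * L))" by (rule of_nat_mono)
    then have "real n / 4 \<le> real (n - 1 - m * L)" by simp
    have "16 * 2 ^ L \<le> (real n / 4) * (2 ^ 16 * h a)"
      using L_up nh by simp
    also have "\<dots> \<le> real (n - 1 - m * L) * h (2 ^ 16 * a)"
      using \<open>real n / 4 \<le> real (n - 1 - m * L)\<close> h_scale_up h0 by (intro mult_mono) auto
    finally have "16 * 2 ^ L \<le> real (n - 1 - m * L) * h (2 ^ 16 * a)" .
    moreover have "m * L + 9 \<le> n" using mL nn by simp
    ultimately have "1 / 2 \<le> measure_pmf.prob (pebble_pmf n (2 ^ 16 * a)) {d. solvable (spider n m L) n d}"
      using a0 L unfolding h_def by (intro prob_spider_solvable_ge) auto
    then show ?thesis by (simp add: a_def)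
  qed
  have "t / 2 ^ 16 \<le> geom_threshold (spider n m L) n" "geom_threshold (spider n m L) n \<le> 2 ^ 16 * t"
    using geom_threshold_between[OF _ _ _ low high] n0 t0 by simp_all
  then show ?thesis using L by blast
qed

theorem theorem28:
  shows "\<exists>K::real. K > 1 \<and>
    (\<forall>n::nat. \<forall>t::real. n \<ge> 2 \<longrightarrow> sqrt (real n) \<le> t \<longrightarrow>
       t \<le> 2 powr (sqrt (2 * log 2 (real n))) / sqrt (log 2 (real n)) * real n \<longrightarrow>
       (\<exists>E. simple_graph E n \<and> connected_graph E n \<and>
            t / K \<le> geom_threshold E n \<and> geom_threshold E n \<le> K * t))"
\<comment> \<open>For \<open>n < 2 ^ 20\<close> the crude upper bound \<open>2 * n\<^sup>2\<close>
  is at most \<open>2 ^ 41\<close>; large \<open>n\<close> need only \<open>2 ^ 16\<close>.\<close>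
proof (intro exI[of _ "2 ^ 41"] conjI allI impI)
  fix n :: nat and t :: real
  assume n: "2 \<le> n" and t: "sqrt (real n) \<le> t"
    "t \<le> 2 powr (sqrt (2 * log 2 (real n))) / sqrt (log 2 (real n)) * real n"
  have "1 \<le> sqrt (real n)" using n by simp
  then have t1: "1 \<le> t" using t(1) by linarith
  have "\<exists>m L. 1 \<le> L \<and> t / 2 ^ 41 \<le> geom_threshold (spider n m L) n \<and>
      geom_threshold (spider n m L) n \<le> 2 ^ 41 * t"
  proof (cases "2 ^ 20 \<le> real n")
    case True
    obtain m L where mL: "1 \<le> L" "t / 2 ^ 16 \<le> geom_threshold (spider n m L) n"
      "geom_threshold (spider n m L) n \<le> 2 ^ 16 * t"
      using exists_spider_threshold[OF True t] by blast
    moreover have "t / 2 ^ 41 \<le> t / 2 ^ 16" "2 ^ 16 * t \<le> 2 ^ 41 * t" using t1 by simp_all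
    ultimately show ?thesis using order_trans by blast
  next
    case False
    define l where "l = log 2 (real n)"
    have l: "1 \<le> l" "l \<le> 20"
      using n False by (simp_all add: l_def le_log_iff log_le_iff powr_realpow)
    have "sqrt (2 * l) \<le> 7"
      using l by (intro real_le_lsqrt) auto
    then have "2 powr (sqrt (2 * l)) \<le> (2::real) powr 7" by (intro powr_mono) auto
    then have "2 powr (sqrt (2 * l)) / sqrt l \<le> 2 powr 7 / 1"
      using l by (intro frac_le) auto
    then have "2 powr (sqrt (2 * l)) / sqrt l * real n \<le> 2 powr 7 / 1 * 2 ^ 20"
      using False by (intro mult_mono) auto
    then have "t \<le> 2 ^ 27" using t(2) by (simp add: l_def)
    then have low: "t / 2 ^ 41 \<le> 1 / 2" by simp
    have "(real n)\<^sup>2 \<le> (2 ^ 20)\<^sup>2" using False by (intro power_mono) auto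
    then have high: "2 * (real n)\<^sup>2 \<le> 2 ^ 41 * t" using t1 by simp
    \<comment> \<open>Without legs the spider is a star; the crude bounds hold for any
      graph.\<close>
    show ?thesis
      using geom_threshold_crude[of n "spider n 0 1"] n low high
      by (intro exI[of _ 0] exI[of _ 1]) auto
  qed
  then show "\<exists>E. simple_graph E n \<and> connected_graph E n \<and>
      t / 2 ^ 41 \<le> geom_threshold E n \<and> geom_threshold E n \<le> 2 ^ 41 * t"
    using simple_graph_spider connected_graph_spider by blast
qed simp

end
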